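(* Let $G=(V,E)$ be a graph, $h,k\in\mathbb{Z}_{>0}$ and $\ell:\{1,\dots,k\}\to\mathbb{Z}_{>0}$. There exists an $h$-regular packing of $k$ forests in $G$ with $\ell(1),\dots,\ell(k)$ connected components, respectively, if and only if all of the following hold: $$|V|\ge\ell(i)\quad\text{for every }1\le i\le k,$$ $$h|V|\ge\sum_{i=1}^k\ell(i),$$ $$\sum_{i=1}^k\min\{\ell(i),|\mathcal{P}|\}+e_E(\mathcal{P})\ \ge\ h|\mathcal{P}|\quad\text{for every partition }\mathcal{P}\text{ of }V.$$
   Context: Graphs are finite and undirected with nonempty vertex set; parallel edges are allowed. For a partition $\mathcal{P}$ of $V$, $e_E(\mathcal{P})$ is the number of edges in $E$ that enter some member of $\mathcal{P}$, i.e. whose end-vertices lie in two different members of $\mathcal{P}$. A packing of $k$ forests in $G$ is a collection $F_1,\dots,F_k$ of pairwise edge-disjoint subgraphs of $G$, each of which is a forest (not necessarily spanning; isolated vertices are allowed, and each counts as a connected component). It is $h$-regular if every vertex of $G$ belongs to exactly $h$ of the forests. *)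

theory Defs
  imports Main "HOL-Library.Disjoint_Sets"
begin

text \<open>Edges are abstract objects with a set of end-vertices, so parallel edges are distinct
  elements of \<open>E\<close>. Loops (where \<open>u = v\<close>) are not excluded; they are cycles of length one, and
  they never enter a member of a partition.\<close>

locale multigraph =
  fixes V :: "'v set" and E :: "'e set" and ends :: "'e \<Rightarrow> 'v set"
  assumes finite_V: "finite V"
    and V_nonempty: "V \<noteq> {}"
    and finite_E: "finite E"
    and ends_E: "\<And>e. e \<in> E \<Longrightarrow> \<exists>u\<in>V. \<exists>v\<in>V. ends e = {u, v}"

definition subgraph_of :: "'v set \<Rightarrow> 'e set \<Rightarrow> ('e \<Rightarrow> 'v set) \<Rightarrow> 'v set \<Rightarrow> 'e set \<Rightarrow> bool" where
  "subgraph_of V E ends W F \<longleftrightarrow> W \<subseteq> V \<and> F \<subseteq> E \<and> (\<forall>e\<in>F. ends e \<subseteq> W)"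

text \<open>The edges are required to be distinct so that two parallel edges form a cycle of length two,
  whereas traversing a single edge back and forth does not.\<close>

definition is_cycle :: "('e \<Rightarrow> 'v set) \<Rightarrow> 'e set \<Rightarrow> 'v list \<Rightarrow> 'e list \<Rightarrow> bool" where
  "is_cycle ends F vs es \<longleftrightarrow>
     vs \<noteq> [] \<and> length es = length vs \<and> distinct vs \<and> distinct es \<and> set es \<subseteq> F \<and>
     (\<forall>i < length vs. ends (es ! i) = {vs ! i, vs ! (Suc i mod length vs)})"

definition acyclic_edges :: "('e \<Rightarrow> 'v set) \<Rightarrow> 'e set \<Rightarrow> bool" where
  "acyclic_edges ends F \<longleftrightarrow> (\<nexists>vs es. is_cycle ends F vs es)"

definition adjacency :: "('e \<Rightarrow> 'v set) \<Rightarrow> 'e set \<Rightarrow> ('v \<times> 'v) set" where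
  "adjacency ends F = {(u, v). \<exists>e\<in>F. ends e = {u, v}}"

text \<open>An isolated vertex of \<open>W\<close> is a component of its own.\<close>

definition components_of :: "('e \<Rightarrow> 'v set) \<Rightarrow> 'v set \<Rightarrow> 'e set \<Rightarrow> 'v set set" where
  "components_of ends W F = W // {(u, v) \<in> W \<times> W. (u, v) \<in> (adjacency ends F)\<^sup>*}"

text \<open>The \<open>i\<close>-th forest has vertex set \<open>W i\<close> and edge set \<open>F i\<close>, for \<open>i \<in> {1..k}\<close>.\<close>

definition forest_packing ::
  "'v set \<Rightarrow> 'e set \<Rightarrow> ('e \<Rightarrow> 'v set) \<Rightarrow> nat \<Rightarrow> (nat \<Rightarrow> 'v set) \<Rightarrow> (nat \<Rightarrow> 'e set) \<Rightarrow> bool" where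
  "forest_packing V E ends k W F \<longleftrightarrow>
     (\<forall>i\<in>{1..k}. subgraph_of V E ends (W i) (F i) \<and> acyclic_edges ends (F i)) \<and>
     disjoint_family_on F {1..k}"

definition regular_packing :: "'v set \<Rightarrow> nat \<Rightarrow> nat \<Rightarrow> (nat \<Rightarrow> 'v set) \<Rightarrow> bool" where
  "regular_packing V h k W \<longleftrightarrow> (\<forall>v\<in>V. card {i \<in> {1..k}. v \<in> W i} = h)"

definition entering_edges :: "'e set \<Rightarrow> ('e \<Rightarrow> 'v set) \<Rightarrow> 'v set set \<Rightarrow> 'e set" where
  "entering_edges E ends P =
     {e \<in> E. \<exists>X\<in>P. \<exists>Y\<in>P. X \<noteq> Y \<and> (\<exists>u\<in>X. \<exists>v\<in>Y. ends e = {u, v})}"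

end

theory Submission
  imports Defs
begin

text \<open>
  Necessity is a count. Contract the members of a partition \<open>P\<close>: the \<open>i\<close>-th forest meets at most
  \<open>min (l i) |P|\<close> members plus one for each of its edges entering \<open>P\<close>, and every member of \<open>P\<close>
  is met by at least \<open>h\<close> forests (\<open>partition_condition_necessary\<close>).

  For sufficiency, mark one vertex in each component of the \<open>i\<close>-th forest of a packing as a root of
  colour \<open>i\<close>. Let \<open>X\<close> be a nonempty vertex set that contains roots of \<open>c\<close> colours. In each forest
  meeting \<open>X\<close>, the edges and roots inside \<open>X\<close> number at most the vertices of the forest in \<open>X\<close>, and
  one less if \<open>X\<close> contains none of its roots. As at least \<open>h\<close> forests meet \<open>X\<close>, in total at most
  \<open>h |X| - h + min h c\<close> edges and roots lie inside \<open>X\<close>, while over all of \<open>V\<close> there are exactly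
  \<open>h |V|\<close> of them. The proof shows that this count is all that matters.

  Call a set of edges and coloured roots sparse if it obeys the bound for every \<open>X\<close>. The sparse sets
  are the independent sets of a matroid, and the reason is uncrossing: both sides of the bound are
  modular up to a term of the right sign, so intersecting sets that attain it are closed under union
  and intersection (\<open>tight_uncross\<close>), and the maximal ones form a partition that certifies the rank
  (\<open>sparse_rank_formula\<close>). The requirement to have \<open>l i\<close> roots of colour \<open>i\<close> and the remaining
  \<open>h |V| - (l 1 + \<dots> + l k)\<close> elements as edges is independence in a partition matroid. By the
  matroid intersection theorem a sparse set of this kind exists (\<open>exists_full_sparse\<close>); the three
  given conditions are what the min-max formula asks for, up to an inequality between colour counts
  (\<open>capped_family_sum\<close>).

  Finally such a set is turned into forests. The forests start as the bare roots. As long as an edge is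
  left, some edge \<open>uv\<close> and some colour \<open>j\<close> present at \<open>u\<close> and absent from \<open>v\<close> are such that
  replacing the edge by a mark of colour \<open>j\<close> at \<open>v\<close> keeps the set sparse (\<open>exists_exchange\<close>); the
  edge joins the \<open>j\<close>-th forest as a pendant edge, which changes neither acyclicity nor the number of
  components. When no edge is left there are \<open>h |V|\<close> marks, at most \<open>h\<close> at each vertex, so exactly
  \<open>h\<close> at each vertex (\<open>grow_forests\<close>).
\<close>

section \<open>Matroid intersection\<close>

definition matroid_rank :: "'a set \<Rightarrow> ('a set \<Rightarrow> nat) \<Rightarrow> bool" where
  "matroid_rank S r \<longleftrightarrow> r {} = 0 \<and> (\<forall>x\<in>S. r {x} \<le> 1) \<and>
     (\<forall>A B. A \<subseteq> B \<longrightarrow> B \<subseteq> S \<longrightarrow> r A \<le> r B) \<and>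
     (\<forall>A B. A \<subseteq> S \<longrightarrow> B \<subseteq> S \<longrightarrow> r (A \<union> B) + r (A \<inter> B) \<le> r A + r B)"

lemma matroid_rankD:
  assumes "matroid_rank S r"
  shows "r {} = 0"
    and "x \<in> S \<Longrightarrow> r {x} \<le> 1"
    and "A \<subseteq> B \<Longrightarrow> B \<subseteq> S \<Longrightarrow> r A \<le> r B"
    and "A \<subseteq> S \<Longrightarrow> B \<subseteq> S \<Longrightarrow> r (A \<union> B) + r (A \<inter> B) \<le> r A + r B"
  using assms unfolding matroid_rank_def by blast+

lemma matroid_rank_subset:
  "matroid_rank S r \<Longrightarrow> S' \<subseteq> S \<Longrightarrow> matroid_rank S' r"
  unfolding matroid_rank_def by (meson subset_iff subset_trans)

lemma matroid_rank_insert_loop: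
  assumes "matroid_rank S r" "r {e} = 0" "e \<in> S" "A \<subseteq> S"
  shows "r (insert e A) = r A"
proof -
  have "r ({e} \<union> A) + r ({e} \<inter> A) \<le> r {e} + r A"
    by (rule matroid_rankD(4)[OF assms(1)]) (use assms in auto)
  moreover have "r A \<le> r (insert e A)"
    by (rule matroid_rankD(3)[OF assms(1)]) (use assms in auto)
  ultimately show ?thesis using assms(2) by simp
qed

text \<open>The rank function of the contraction by a non-loop \<open>e\<close>.\<close>

lemma matroid_rank_contract:
  assumes r: "matroid_rank (insert e S) r" and e: "r {e} = 1"
  shows "matroid_rank S (\<lambda>A. r (insert e A) - 1)"
    and "A \<subseteq> S \<Longrightarrow> r (insert e A) \<ge> 1"
proof -
  show ge: "r (insert e A) \<ge> 1" if "A \<subseteq> S" for A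
    using matroid_rankD(3)[OF r, of "{e}" "insert e A"] that e by auto
  show "matroid_rank S (\<lambda>A. r (insert e A) - 1)"
    unfolding matroid_rank_def
  proof (intro conjI ballI allI impI)
    show "r {e} - 1 = 0" using e by simp
  next
    fix x assume "x \<in> S"
    then show "r {e, x} - 1 \<le> 1"
      using matroid_rankD(4)[OF r, of "{e}" "{x}"] matroid_rankD(2)[OF r, of x] e
      by (simp add: insert_commute)
  next
    fix A B assume "A \<subseteq> B" "B \<subseteq> S"
    then show "r (insert e A) - 1 \<le> r (insert e B) - 1"
      by (intro diff_le_mono matroid_rankD(3)[OF r]) auto
  next
    fix A B assume AB: "A \<subseteq> S" "B \<subseteq> S"
    have "insert e A \<union> insert e B = insert e (A \<union> B)"
      "insert e A \<inter> insert e B = insert e (A \<inter> B)" by auto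
    then have "r (insert e (A \<union> B)) + r (insert e (A \<inter> B)) \<le> r (insert e A) + r (insert e B)"
      using matroid_rankD(4)[OF r, of "insert e A" "insert e B"] AB by (metis insert_mono)
    then show "r (insert e (A \<union> B)) - 1 + (r (insert e (A \<inter> B)) - 1)
        \<le> r (insert e A) - 1 + (r (insert e B) - 1)"
      using ge[of "A \<union> B"] ge[of "A \<inter> B"] AB le_infI1[of A S B] by simp
  qed
qed

text \<open>Induction on the ground set: either deleting or contracting \<open>e\<close> preserves the min-max
  condition. If both failed, a set \<open>A\<close> violating the condition after deletion and a set \<open>B\<close>
  violating it after contraction could be uncrossed: by submodularity of both ranks, one of
  \<open>A \<inter> B\<close> and \<open>A \<union> B \<union> {e}\<close> would violate the original condition.\<close>

theorem matroid_intersection: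
  assumes "finite S" "matroid_rank S r1" "matroid_rank S r2"
    and "\<And>A. A \<subseteq> S \<Longrightarrow> n \<le> r1 A + r2 (S - A)"
  shows "\<exists>I\<subseteq>S. card I = n \<and> r1 I = n \<and> r2 I = n"
  using assms
proof (induction S arbitrary: r1 r2 n rule: finite_induct)
  case empty
  then have "r1 {} = 0" "r2 {} = 0" using matroid_rankD(1) by auto
  moreover from this have "n = 0" using empty.prems(3)[of "{}"] by simp
  ultimately show ?case by auto
next
  case (insert e S)
  note r1 = insert.prems(1) and r2 = insert.prems(2)
  show ?case
  proof (cases "\<forall>A\<subseteq>S. n \<le> r1 A + r2 (S - A)")
    case True
    have "\<exists>I\<subseteq>S. card I = n \<and> r1 I = n \<and> r2 I = n"
      using True r1 r2 by (intro insert.IH) (auto intro: matroid_rank_subset)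
    then show ?thesis by blast
  next
    case False
    then obtain A where A: "A \<subseteq> S" "r1 A + r2 (S - A) < n" by (auto simp: not_le)
    \<comment> \<open>A loop of either matroid could be moved to the side where it has rank 0, and would turn
      \<open>A\<close> into a violation of the hypothesis.\<close>
    have "r1 {e} \<noteq> 0"
    proof
      assume "r1 {e} = 0"
      then have "r1 (insert e A) = r1 A"
        using A by (intro matroid_rank_insert_loop[OF r1]) auto
      moreover have "insert e S - insert e A = S - A" using insert.hyps by auto
      ultimately show False using insert.prems(3)[of "insert e A"] A by (auto simp: insert_mono)
    qed
    then have e1: "r1 {e} = 1" using matroid_rankD(2)[OF r1, of e] by simp
    have "r2 {e} \<noteq> 0"
    proof
      assume "r2 {e} = 0"
      then have "r2 (insert e (S - A)) = r2 (S - A)"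
        by (intro matroid_rank_insert_loop[OF r2]) auto
      moreover have "insert e S - A = insert e (S - A)" using insert.hyps A by auto
      ultimately show False using insert.prems(3)[of A] A by auto
    qed
    then have e2: "r2 {e} = 1" using matroid_rankD(2)[OF r2, of e] by simp
    have "n - 1 \<le> r1 (insert e B) - 1 + (r2 (insert e (S - B)) - 1)" if B: "B \<subseteq> S" for B
    proof -
      have u1: "r1 (A \<union> insert e B) + r1 (A \<inter> insert e B) \<le> r1 A + r1 (insert e B)"
        using A B by (intro matroid_rankD(4)[OF r1]) auto
      have u2: "r2 ((S - A) \<union> insert e (S - B)) + r2 ((S - A) \<inter> insert e (S - B))
          \<le> r2 (S - A) + r2 (insert e (S - B))"
        by (intro matroid_rankD(4)[OF r2]) auto
      have s: "insert e S - (A \<union> insert e B) = (S - A) \<inter> insert e (S - B)"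
        "insert e S - (A \<inter> insert e B) = (S - A) \<union> insert e (S - B)"
        using A B insert.hyps by auto
      have "n \<le> r1 (A \<union> insert e B) + r2 ((S - A) \<inter> insert e (S - B))"
        using insert.prems(3)[of "A \<union> insert e B"] A B s by auto
      moreover have "n \<le> r1 (A \<inter> insert e B) + r2 ((S - A) \<union> insert e (S - B))"
        using insert.prems(3)[of "A \<inter> insert e B"] A B s by auto
      ultimately show ?thesis using u1 u2 A by linarith
    qed
    then obtain I where I: "I \<subseteq> S" "card I = n - 1"
      "r1 (insert e I) - 1 = n - 1" "r2 (insert e I) - 1 = n - 1"
      using insert.IH[OF matroid_rank_contract(1)[OF r1 e1] matroid_rank_contract(1)[OF r2 e2], of "n - 1"]
      by auto
    have "card (insert e I) = n"
      using I A insert.hyps by (subst card_insert_disjoint) (auto intro: finite_subset)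
    moreover have "r1 (insert e I) = n" "r2 (insert e I) = n"
      using I(3,4) A matroid_rank_contract(2)[OF r1 e1 I(1)] matroid_rank_contract(2)[OF r2 e2 I(1)]
      by linarith+
    ultimately show ?thesis using I(1) by (intro exI[of _ "insert e I"]) auto
  qed
qed

text \<open>Independence systems in which all maximal independent subsets of any \<open>A \<subseteq> S\<close> have the same
  size; the second independent set \<open>J\<close> need not be maximal, which saves an extension step when the
  property is verified.\<close>

definition matroid_indep :: "'a set \<Rightarrow> ('a set \<Rightarrow> bool) \<Rightarrow> bool" where
  "matroid_indep S ind \<longleftrightarrow> finite S \<and> ind {} \<and> (\<forall>I J. ind J \<longrightarrow> J \<subseteq> S \<longrightarrow> I \<subseteq> J \<longrightarrow> ind I) \<and>
     (\<forall>A I J. A \<subseteq> S \<longrightarrow> I \<subseteq> A \<longrightarrow> ind I \<longrightarrow> (\<forall>x\<in>A - I. \<not> ind (insert x I)) \<longrightarrow>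
        J \<subseteq> A \<longrightarrow> ind J \<longrightarrow> card J \<le> card I)"

lemma matroid_indepD:
  assumes "matroid_indep S ind"
  shows "A \<subseteq> S \<Longrightarrow> finite A"
    and "ind {}"
    and "ind J \<Longrightarrow> J \<subseteq> S \<Longrightarrow> I \<subseteq> J \<Longrightarrow> ind I"
    and "A \<subseteq> S \<Longrightarrow> I \<subseteq> A \<Longrightarrow> ind I \<Longrightarrow> \<forall>x\<in>A - I. \<not> ind (insert x I) \<Longrightarrow>
      J \<subseteq> A \<Longrightarrow> ind J \<Longrightarrow> card J \<le> card I"
  using assms finite_subset[of A S] unfolding matroid_indep_def by meson+

definition indep_rank :: "('a set \<Rightarrow> bool) \<Rightarrow> 'a set \<Rightarrow> nat" where
  "indep_rank ind A = Max (card ` {I. I \<subseteq> A \<and> ind I})"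

lemma maximal_indep_extension:
  assumes "finite A" "I \<subseteq> A" "ind I"
  obtains K where "I \<subseteq> K" "K \<subseteq> A" "ind K" "\<forall>x\<in>A - K. \<not> ind (insert x K)"
proof -
  have "finite {K. K \<subseteq> A \<and> ind K}" using assms(1) by simp
  moreover have "I \<in> {K. K \<subseteq> A \<and> ind K}" using assms by simp
  ultimately have "\<exists>K\<in>{K. K \<subseteq> A \<and> ind K}. I \<subseteq> K \<and> (\<forall>L\<in>{K. K \<subseteq> A \<and> ind K}. K \<subseteq> L \<longrightarrow> K = L)"
    by (rule finite_has_maximal2)
  then obtain K where K: "K \<in> {K. K \<subseteq> A \<and> ind K}" "I \<subseteq> K"
    and max: "\<forall>L\<in>{K. K \<subseteq> A \<and> ind K}. K \<subseteq> L \<longrightarrow> K = L"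
    by (elim bexE conjE)
  have "\<not> ind (insert x K)" if x: "x \<in> A - K" for x
  proof
    assume "ind (insert x K)"
    then have "insert x K \<in> {K. K \<subseteq> A \<and> ind K}" using K(1) x by simp
    then have "K \<subseteq> insert x K \<longrightarrow> K = insert x K" by (rule bspec[OF max])
    then show False using x by blast
  qed
  then show thesis using K by (intro that[of K]) simp_all
qed

lemma indep_rank_ge:
  assumes "finite A" "I \<subseteq> A" "ind I"
  shows "card I \<le> indep_rank ind A"
  unfolding indep_rank_def using assms by (intro Max_ge) auto

lemma indep_rank_maximal:
  assumes m: "matroid_indep S ind" and A: "A \<subseteq> S"
    and I: "I \<subseteq> A" "ind I" "\<forall>x\<in>A - I. \<not> ind (insert x I)"
  shows "indep_rank ind A = card I"
proof -
  have "finite A" by (rule matroid_indepD(1)[OF m A])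
  then show ?thesis
    unfolding indep_rank_def using I matroid_indepD(4)[OF m A I] by (intro Max_eqI) auto
qed

lemma indep_rank_attained:
  assumes m: "matroid_indep S ind" and A: "A \<subseteq> S"
  obtains I where "I \<subseteq> A" "ind I" "card I = indep_rank ind A"
    "\<forall>x\<in>A - I. \<not> ind (insert x I)"
proof -
  note fin = matroid_indepD(1)[OF m A] and ind = matroid_indepD(2)[OF m]
  obtain I where "{} \<subseteq> I" "I \<subseteq> A" "ind I" "\<forall>x\<in>A - I. \<not> ind (insert x I)"
    by (rule maximal_indep_extension[of A "{}" ind, OF fin empty_subsetI ind])
  then show thesis by (intro that[of I] indep_rank_maximal[OF m A, symmetric])
qed

lemma indep_if_rank_eq_card:
  assumes m: "matroid_indep S ind" and A: "A \<subseteq> S" "indep_rank ind A = card A"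
  shows "ind A"
proof -
  obtain I where I: "I \<subseteq> A" "ind I" "card I = card A"
    by (rule indep_rank_attained[OF m A(1)]) (simp add: A(2))
  have "I = A" using card_subset_eq[OF matroid_indepD(1)[OF m A(1)] I(1,3)] .
  then show ?thesis using I(2) by simp
qed

text \<open>Submodularity: a maximal independent subset \<open>I\<close> of \<open>A \<inter> B\<close> extends to a maximal one \<open>K\<close> of
  \<open>A \<union> B\<close>, and counting \<open>K\<close> separately in \<open>A\<close> and in \<open>B\<close> counts \<open>I\<close> twice.\<close>

lemma matroid_rank_indep_rank:
  assumes m: "matroid_indep S ind"
  shows "matroid_rank S (indep_rank ind)"
proof -
  note fin = matroid_indepD(1)[OF m] and her = matroid_indepD(3)[OF m]
  have le: "indep_rank ind A \<le> card A" if A: "A \<subseteq> S" for A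
  proof -
    obtain I where "I \<subseteq> A" "card I = indep_rank ind A"
      by (rule indep_rank_attained[OF m A])
    then show ?thesis using card_mono[OF fin[OF A]] by metis
  qed
  show ?thesis
    unfolding matroid_rank_def
  proof (intro conjI ballI allI impI)
    show "indep_rank ind {} = 0" using le[of "{}"] by simp
  next
    fix x assume "x \<in> S"
    then show "indep_rank ind {x} \<le> 1" using le[of "{x}"] by simp
  next
    fix A B assume AB: "A \<subseteq> B" "B \<subseteq> S"
    obtain I where "I \<subseteq> A" "ind I" "card I = indep_rank ind A"
      by (rule indep_rank_attained[OF m subset_trans[OF AB]])
    then show "indep_rank ind A \<le> indep_rank ind B"
      using indep_rank_ge[of B I ind] fin AB by auto
  next
    fix A B assume AB: "A \<subseteq> S" "B \<subseteq> S"
    obtain I where I: "I \<subseteq> A \<inter> B" "ind I" "card I = indep_rank ind (A \<inter> B)"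
      by (rule indep_rank_attained[OF m le_infI1[OF AB(1)]])
    obtain K where K: "I \<subseteq> K" "K \<subseteq> A \<union> B" "ind K" "\<forall>x\<in>A \<union> B - K. \<not> ind (insert x K)"
      using fin[OF Un_least[OF AB]] le_supI1[OF subset_trans[OF I(1) Int_lower1]] I(2)
      by (rule maximal_indep_extension)
    have K': "card K = indep_rank ind (A \<union> B)"
      using indep_rank_maximal[OF m _ K(2-4)] AB by simp
    have finK: "finite K" using K(2) fin[OF Un_least[OF AB]] by (rule finite_subset)
    have "card (K \<inter> A) \<le> indep_rank ind A" "card (K \<inter> B) \<le> indep_rank ind B"
      using her[OF K(3)] K(2) AB fin by (auto intro!: indep_rank_ge)
    moreover have "card (K \<inter> A) + card (K \<inter> B) = card (K \<inter> A \<union> K \<inter> B) + card (K \<inter> A \<inter> (K \<inter> B))"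
      using finK by (intro card_Un_Int) auto
    moreover have "K \<inter> A \<union> K \<inter> B = K" using K(2) by auto
    moreover have "card I \<le> card (K \<inter> A \<inter> (K \<inter> B))"
      using I K finK by (intro card_mono) auto
    ultimately show "indep_rank ind (A \<union> B) + indep_rank ind (A \<inter> B)
        \<le> indep_rank ind A + indep_rank ind B"
      using I(3) K' by simp
  qed
qed

lemma min_card_submodular:
  assumes "finite A" "finite B"
  shows "min c (card (A \<union> B)) + min c (card (A \<inter> B)) \<le> min c (card A) + min (c::nat) (card B)"
proof -
  have "card A + card B = card (A \<union> B) + card (A \<inter> B)" using assms by (rule card_Un_Int)
  moreover have "card (A \<inter> B) \<le> card A" "card (A \<inter> B) \<le> card B"
    using assms by (auto intro: card_mono)
  ultimately show ?thesis by (simp add: min_def)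
qed

lemma matroid_rank_partition:
  assumes "finite S" "finite C"
  shows "matroid_rank S (\<lambda>A. \<Sum>j\<in>C. min (cap j :: nat) (card {x\<in>A. cl x = j}))"
  unfolding matroid_rank_def
proof (intro conjI ballI allI impI)
  show "(\<Sum>j\<in>C. min (cap j) (card {x \<in> {}. cl x = j})) = 0" by simp
next
  fix x
  have "(\<Sum>j\<in>C. min (cap j) (card {y \<in> {x}. cl y = j})) \<le> (\<Sum>j\<in>C. if j = cl x then 1 else 0)"
  proof (rule sum_mono)
    fix j
    have "{y \<in> {x}. cl y = j} = (if j = cl x then {x} else {})" by auto
    then show "min (cap j) (card {y \<in> {x}. cl y = j}) \<le> (if j = cl x then 1 else 0)" by auto
  qed
  also have "\<dots> \<le> 1" using assms(2) by simp
  finally show "(\<Sum>j\<in>C. min (cap j) (card {y \<in> {x}. cl y = j})) \<le> 1" .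
next
  fix A B assume AB: "A \<subseteq> B" "B \<subseteq> S"
  then have "finite B" using assms finite_subset by auto
  then show "(\<Sum>j\<in>C. min (cap j) (card {x \<in> A. cl x = j}))
      \<le> (\<Sum>j\<in>C. min (cap j) (card {x \<in> B. cl x = j}))"
    using AB by (intro sum_mono min.mono card_mono) auto
next
  fix A B assume AB: "A \<subseteq> S" "B \<subseteq> S"
  then have f: "finite A" "finite B" using assms finite_subset by auto
  have "{x \<in> A \<union> B. cl x = j} = {x \<in> A. cl x = j} \<union> {x \<in> B. cl x = j}"
    "{x \<in> A \<inter> B. cl x = j} = {x \<in> A. cl x = j} \<inter> {x \<in> B. cl x = j}" for j by auto
  then show "(\<Sum>j\<in>C. min (cap j) (card {x \<in> A \<union> B. cl x = j}))
        + (\<Sum>j\<in>C. min (cap j) (card {x \<in> A \<inter> B. cl x = j}))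
      \<le> (\<Sum>j\<in>C. min (cap j) (card {x \<in> A. cl x = j}))
        + (\<Sum>j\<in>C. min (cap j) (card {x \<in> B. cl x = j}))"
    using f by (simp add: sum.distrib[symmetric] sum_mono min_card_submodular)
qed

section \<open>An inequality for families of colour sets\<close>

text \<open>The function \<open>g n = (\<Sum>j\<in>C. min (l j) n) - h n\<close> is concave with \<open>g 0 = 0\<close>, hence
  \<open>min 0 (g n) \<le> g q\<close> for \<open>q \<le> n\<close>. The two cases below say whether \<open>g\<close> decreases
  after \<open>q\<close> or increases up to \<open>q\<close>.\<close>

lemma capped_sum_concave:
  fixes l :: "nat \<Rightarrow> nat"
  assumes q: "q \<le> n" and C: "finite C"
  shows "min (h * n) (\<Sum>j\<in>C. min (l j) n) \<le> h * (n - q) + (\<Sum>j\<in>C. min (l j) q)"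
proof -
  let ?a = "card {j\<in>C. l j > q}"
  have ind: "(\<Sum>j\<in>C. if l j > q then c else 0) = ?a * c" for c :: nat
    using C by (simp add: sum.If_cases Int_def)
  show ?thesis
  proof (cases "?a \<le> h")
    case True
    have "(\<Sum>j\<in>C. min (l j) n) \<le> (\<Sum>j\<in>C. min (l j) q + (if l j > q then n - q else 0))"
      using q by (intro sum_mono) auto
    also have "\<dots> = (\<Sum>j\<in>C. min (l j) q) + ?a * (n - q)" by (simp add: sum.distrib ind)
    also have "\<dots> \<le> (\<Sum>j\<in>C. min (l j) q) + h * (n - q)" using True by simp
    finally show ?thesis by simp
  next
    case False
    then have "h * q \<le> ?a * q" by simp
    also have "\<dots> = (\<Sum>j\<in>C. if l j > q then q else 0)" by (simp add: ind)
    also have "\<dots> \<le> (\<Sum>j\<in>C. min (l j) q)" by (intro sum_mono) auto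
    finally have "h * (n - q) + h * q \<le> h * (n - q) + (\<Sum>j\<in>C. min (l j) q)" by simp
    moreover have "h * (n - q) + h * q = h * n" using q by (simp flip: distrib_left)
    ultimately show ?thesis by simp
  qed
qed

text \<open>This reduces the min-max formula, in which an arbitrary set of colours may be chosen for each
  member of a partition, to the case where each member has either no colour or all of them. A member
  with at least \<open>h\<close> colours contributes \<open>h\<close>. For the other members, collected in \<open>Q\<close>, the
  contributions are exchanged colour by colour: a colour that belongs to \<open>a\<close> of them and misses
  \<open>b = |Q| - a\<close> contributes at least \<open>a + min (l j) b \<ge> min (l j) |Q|\<close>.\<close>

lemma capped_family_sum:
  fixes l :: "nat \<Rightarrow> nat"
  assumes P: "finite P" and C: "finite C" and J: "\<And>X. X \<in> P \<Longrightarrow> J X \<subseteq> C"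
  shows "min (h * card P) (\<Sum>j\<in>C. min (l j) (card P))
      \<le> (\<Sum>X\<in>P. min h (card (J X))) + (\<Sum>j\<in>C. min (l j) (card {X\<in>P. j \<notin> J X}))"
proof -
  define Q where "Q = {X\<in>P. card (J X) < h}"
  have Q: "finite Q" "Q \<subseteq> P" using P by (auto simp: Q_def)
  have "(\<Sum>X\<in>P. min h (card (J X))) = (\<Sum>X\<in>Q. min h (card (J X))) + (\<Sum>X\<in>P - Q. min h (card (J X)))"
    using sum.subset_diff[OF Q(2) P, of "\<lambda>X. min h (card (J X))"] by simp
  also have "(\<Sum>X\<in>Q. min h (card (J X))) = (\<Sum>X\<in>Q. card (J X))"
    by (intro sum.cong) (auto simp: Q_def)
  also have "(\<Sum>X\<in>P - Q. min h (card (J X))) = (\<Sum>X\<in>P - Q. h)"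
    by (intro sum.cong) (auto simp: Q_def)
  also have "(\<Sum>X\<in>P - Q. h) = h * (card P - card Q)"
    using Q by (simp add: card_Diff_subset)
  also have "(\<Sum>X\<in>Q. card (J X)) = (\<Sum>X\<in>Q. card {j\<in>C. j \<in> J X})"
    using J Q by (intro sum.cong arg_cong[where f = card]) auto
  also have "\<dots> = (\<Sum>j\<in>C. card {X\<in>Q. j \<in> J X})"
    using sum_multicount_gen[OF Q(1) C, of "\<lambda>X j. j \<in> J X" "\<lambda>j. card {X\<in>Q. j \<in> J X}"]
    by simp
  finally have 1: "(\<Sum>X\<in>P. min h (card (J X)))
      = (\<Sum>j\<in>C. card {X\<in>Q. j \<in> J X}) + h * (card P - card Q)" .
  have "(\<Sum>j\<in>C. min (l j) (card Q))
      \<le> (\<Sum>j\<in>C. card {X\<in>Q. j \<in> J X} + min (l j) (card {X\<in>P. j \<notin> J X}))"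
  proof (rule sum_mono)
    fix j
    have "card Q = card {X\<in>Q. j \<in> J X} + card {X\<in>Q. j \<notin> J X}"
      using Q by (subst card_Un_disjoint[symmetric]) (auto intro: arg_cong[where f = card])
    moreover have "card {X\<in>Q. j \<notin> J X} \<le> card {X\<in>P. j \<notin> J X}"
      using P Q by (intro card_mono) auto
    ultimately show "min (l j) (card Q)
        \<le> card {X\<in>Q. j \<in> J X} + min (l j) (card {X\<in>P. j \<notin> J X})" by linarith
  qed
  then have "h * (card P - card Q) + (\<Sum>j\<in>C. min (l j) (card Q))
      \<le> (\<Sum>X\<in>P. min h (card (J X))) + (\<Sum>j\<in>C. min (l j) (card {X\<in>P. j \<notin> J X}))"
    unfolding 1 by (simp add: sum.distrib)
  moreover have "min (h * card P) (\<Sum>j\<in>C. min (l j) (card P))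
      \<le> h * (card P - card Q) + (\<Sum>j\<in>C. min (l j) (card Q))"
    using C card_mono[OF P Q(2)] by (intro capped_sum_concave) auto
  ultimately show ?thesis by simp
qed

section \<open>Forests\<close>

text \<open>A cycle through the new edge \<open>e\<close> would pass through \<open>v\<close>, and both edges of the cycle at \<open>v\<close>
  would have to be \<open>e\<close>. So the cycle would have length one, but \<open>e\<close> is not a loop.\<close>

lemma acyclic_edges_pendant:
  assumes F: "acyclic_edges ends F" and e: "ends e = {u, v}" "u \<noteq> v"
    and v: "\<And>f. f \<in> F \<Longrightarrow> v \<notin> ends f"
  shows "acyclic_edges ends (insert e F)"
  unfolding acyclic_edges_def
proof (intro notI, elim exE)
  fix vs es assume c: "is_cycle ends (insert e F) vs es"
  let ?n = "length vs"
  have c': "vs \<noteq> []" "length es = ?n" "distinct es" "set es \<subseteq> insert e F"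
    and inc: "\<And>i. i < ?n \<Longrightarrow> ends (es ! i) = {vs ! i, vs ! (Suc i mod ?n)}"
    using c unfolding is_cycle_def by auto
  have n0: "?n > 0" using c' by simp
  have "e \<in> set es"
  proof (rule ccontr)
    assume "e \<notin> set es"
    then have "is_cycle ends F vs es" using c unfolding is_cycle_def by auto
    then show False using F unfolding acyclic_edges_def by blast
  qed
  then obtain i where i: "i < ?n" "es ! i = e" using c'(2) by (metis in_set_conv_nth)
  then have "v = vs ! i \<or> v = vs ! (Suc i mod ?n)" using inc[of i] e by auto
  then obtain p where p: "p < ?n" "vs ! p = v" using i(1) n0 mod_less_divisor by blast
  have only_e: "es ! q = e" if "q < ?n" "v \<in> ends (es ! q)" for q
    using that c' v by (metis insert_iff nth_mem subset_iff)
  \<comment> \<open>the position of the cycle edge that arrives at \<open>v\<close>\<close>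
  let ?q = "(p + ?n - 1) mod ?n"
  have q: "?q < ?n" using n0 by simp
  have "Suc ?q mod ?n = (p + ?n) mod ?n" using n0 by (simp add: mod_Suc_eq)
  also have "\<dots> = p" using p by simp
  finally have qp: "Suc ?q mod ?n = p" .
  have "es ! p = e" using only_e[OF p(1)] inc[OF p(1)] p by auto
  moreover have "es ! ?q = e" using only_e[OF q] inc[OF q] qp p by auto
  ultimately have "p = ?q" using c' p(1) q nth_eq_iff_index_eq by metis
  then have "ends e = {v}"
    using inc[OF p(1)] qp p(2) \<open>es ! p = e\<close> by simp
  then show False using e by auto
qed

text \<open>Folding the leaf \<open>v\<close> onto its neighbour \<open>u\<close> preserves and reflects connectedness, so taking
  preimages under the folding map \<open>p\<close> is a bijection between the components.\<close>

lemma card_components_pendant: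
  assumes u: "u \<in> W" and v: "v \<notin> W" and e: "ends e = {u, v}"
    and F: "\<And>f. f \<in> F \<Longrightarrow> ends f \<subseteq> W"
  shows "card (components_of ends (insert v W) (insert e F)) = card (components_of ends W F)"
proof -
  define p where "p x = (if x = v then u else x)" for x
  let ?A = "adjacency ends F" and ?A' = "adjacency ends (insert e F)"
  let ?R = "{(x, y) \<in> W \<times> W. (x, y) \<in> ?A\<^sup>*}"
  let ?R' = "{(x, y) \<in> insert v W \<times> insert v W. (x, y) \<in> ?A'\<^sup>*}"
  have A': "?A' = insert (u, v) (insert (v, u) ?A)"
    unfolding adjacency_def using e by (auto simp: doubleton_eq_iff)
  have A: "?A \<subseteq> W \<times> W" unfolding adjacency_def using F by fastforce
  have pA: "(p x, p y) \<in> ?A\<^sup>*" if "(x, y) \<in> ?A'\<^sup>*" for x y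
    using that
  proof (induction rule: rtrancl_induct)
    case (step y z)
    then have "(p y, p z) \<in> ?A\<^sup>*" using A A' v u by (auto simp: p_def)
    then show ?case using step by auto
  qed simp
  have xp: "(x, p x) \<in> ?A'\<^sup>*" "(p x, x) \<in> ?A'\<^sup>*" for x
    by (auto simp: p_def A')
  have Ap: "(x, y) \<in> ?A'\<^sup>*" if "(p x, p y) \<in> ?A\<^sup>*" for x y
  proof -
    have "?A\<^sup>* \<subseteq> ?A'\<^sup>*" by (intro rtrancl_mono) (auto simp: A')
    then show ?thesis using that xp by (meson rtrancl_trans subset_iff)
  qed
  define g where "g C = {y \<in> insert v W. p y \<in> C}" for C
  have cls: "?R' `` {x} = g (?R `` {p x})" if "x \<in> insert v W" for x
  proof -
    have px: "p y \<in> W" if "y \<in> insert v W" for y using that u by (auto simp: p_def)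
    have "(x, y) \<in> ?A'\<^sup>* \<longleftrightarrow> (p x, p y) \<in> ?A\<^sup>*" for y using pA Ap by blast
    then show ?thesis using that px by (auto simp: g_def)
  qed
  have surj: "p ` insert v W = W" using u v by (auto simp: p_def)
  have "insert v W // ?R' = (\<lambda>x. g (?R `` {p x})) ` insert v W"
    unfolding quotient_def using cls by auto
  also have "\<dots> = g ` (\<lambda>x. ?R `` {x}) ` (p ` insert v W)" by (simp only: image_image)
  also have "\<dots> = g ` (W // ?R)" unfolding surj quotient_def by auto
  finally have "components_of ends (insert v W) (insert e F) = g ` components_of ends W F"
    unfolding components_of_def .
  moreover have "inj_on g (components_of ends W F)"
  proof (rule inj_onI)
    fix C D assume CD: "C \<in> components_of ends W F" "D \<in> components_of ends W F" "g C = g D"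
    then have sub: "C \<subseteq> W" "D \<subseteq> W" unfolding components_of_def quotient_def by blast+
    have pg: "p ` g B = B" if "B \<subseteq> W" for B
    proof -
      have "p ` g B = p ` insert v W \<inter> B" unfolding g_def by blast
      then show ?thesis unfolding surj using that by (simp add: inf_absorb2)
    qed
    have "C = p ` g C" using pg[OF sub(1)] by (rule sym)
    also have "\<dots> = D" unfolding CD(3) by (rule pg[OF sub(2)])
    finally show "C = D" .
  qed
  ultimately show ?thesis by (simp add: card_image)
qed

lemma card_components_edgeless: "card (components_of ends W {}) = card W"
proof -
  have "components_of ends W {} = (\<lambda>x. {x}) ` W"
    unfolding components_of_def quotient_def adjacency_def by auto
  then show ?thesis by (simp add: card_image)
qed

lemma card_components_le: "finite W \<Longrightarrow> card (components_of ends W F) \<le> card W"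
  unfolding components_of_def quotient_def by (simp add: UNION_singleton_eq_range card_image_le)

text \<open>A map that is constant along all edges but those in \<open>F0\<close> takes at most one value per component,
  plus one for each edge in \<open>F0\<close>. An edge of \<open>F0\<close> is disposed of by identifying the values at its
  two ends, which loses at most one value.\<close>

lemma card_image_le_components:
  assumes W: "finite W" and "finite F0"
    and "\<And>e a b. e \<in> F - F0 \<Longrightarrow> ends e = {a, b} \<Longrightarrow> f a = f b"
  shows "card (f ` W) \<le> card (components_of ends W F) + card F0"
  using assms(2,3)
proof (induction F0 arbitrary: f rule: finite_induct)
  case empty
  let ?R = "{(x, y) \<in> W \<times> W. (x, y) \<in> (adjacency ends F)\<^sup>*}"
  have const: "f x = f y" if "(x, y) \<in> (adjacency ends F)\<^sup>*" for x y
    using that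
  proof (induction rule: rtrancl_induct)
    case (step y z)
    then show ?case using empty unfolding adjacency_def by auto
  qed simp
  have "f ` W \<subseteq> (\<lambda>C. f (SOME x. x \<in> C)) ` (W // ?R)"
  proof
    fix c assume "c \<in> f ` W"
    then obtain x where x: "x \<in> W" "c = f x" by auto
    have "x \<in> ?R `` {x}" using x by auto
    then have "(SOME y. y \<in> ?R `` {x}) \<in> ?R `` {x}" by (rule someI)
    then have "f x = f (SOME y. y \<in> ?R `` {x})" using const by auto
    then show "c \<in> (\<lambda>C. f (SOME x. x \<in> C)) ` (W // ?R)"
      using x by (auto intro!: image_eqI quotientI)
  qed
  moreover have "finite (W // ?R)" unfolding quotient_def using W by simp
  ultimately show ?case unfolding components_of_def by (simp add: surj_card_le)
next
  case (insert e F0)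
  show ?case
  proof (cases "\<exists>a b. ends e = {a, b}")
    case False
    then have "card (f ` W) \<le> card (components_of ends W F) + card F0"
      using insert.prems by (intro insert.IH) blast
    then show ?thesis using insert.hyps by simp
  next
    case True
    then obtain a b where ab: "ends e = {a, b}" by blast
    define g where "g x = (if f x = f b then f a else f x)" for x
    have "card (g ` W) \<le> card (components_of ends W F) + card F0"
    proof (rule insert.IH)
      fix e' c d assume e': "e' \<in> F - F0" "ends e' = {c, d}"
      show "g c = g d"
      proof (cases "e' = e")
        case True
        then show ?thesis using ab e' by (auto simp: g_def doubleton_eq_iff)
      next
        case False
        then have "f c = f d" using insert.prems e' by blast
        then show ?thesis by (simp add: g_def)
      qed
    qed
    moreover have "f ` W \<subseteq> insert (f b) (g ` W)" by (auto simp: g_def)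
    then have "card (f ` W) \<le> card (insert (f b) (g ` W))" using W by (intro card_mono) auto
    then have "card (f ` W) \<le> card (g ` W) + 1"
      using W by (simp add: card_insert_if split: if_splits)
    ultimately show ?thesis using insert.hyps by simp
  qed
qed

section \<open>The count matroid of edges and coloured roots\<close>

text \<open>Elements \<open>Inl e\<close> are edges and elements \<open>Inr (v, j)\<close> are roots of colour \<open>j\<close> placed at \<open>v\<close>.
  Treating both alike through the set of vertices they live on makes the number of elements inside
  \<open>X\<close> a single supermodular function.\<close>

fun support :: "('e \<Rightarrow> 'v set) \<Rightarrow> 'e + 'v \<times> nat \<Rightarrow> 'v set" where
  "support ends (Inl e) = ends e"
| "support ends (Inr (v, j)) = {v}"

definition colours :: "('e + 'v \<times> nat) set \<Rightarrow> 'v set \<Rightarrow> nat set" where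
  "colours A X = {j. \<exists>v\<in>X. Inr (v, j) \<in> A}"

text \<open>Roots have colours \<open>1, \<dots>, k\<close>, which leaves the value 0 for the edges: the edges then count
  as one more colour class, with a cap of their own.\<close>

definition colour_of :: "'e + 'v \<times> nat \<Rightarrow> nat" where
  "colour_of = case_sum (\<lambda>_. 0) snd"

lemma same_part:
  assumes "partition_on V P" "X \<in> P" "Y \<in> P" "v \<in> X" "v \<in> Y"
  shows "X = Y"
proof (rule ccontr)
  assume "X \<noteq> Y"
  then have "X \<inter> Y = {}" by (rule disjointD[OF partition_onD2[OF assms(1)] assms(2,3)])
  then show False using assms(4,5) by blast
qed

locale coloured_multigraph = multigraph V E ends
  for V :: "'v set" and E :: "'e set" and ends :: "'e \<Rightarrow> 'v set" +
  fixes h k :: nat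
begin

definition ground :: "('e + 'v \<times> nat) set" where
  "ground = Inl ` E \<union> Inr ` (V \<times> {1..k})"

definition inside :: "('e + 'v \<times> nat) set \<Rightarrow> 'v set \<Rightarrow> ('e + 'v \<times> nat) set" where
  "inside A X = {x\<in>A. support ends x \<subseteq> X}"

text \<open>The rank function of the uniform matroid on the colours: a vertex lies in \<open>h\<close> forests, so
  colours beyond the first \<open>h\<close> bring nothing new.\<close>

definition colour_rank :: "nat set \<Rightarrow> nat" where
  "colour_rank J = min h (card J)"

text \<open>The bound is \<open>h (|X| - 1) + colour_rank (colours A X)\<close>, written without subtraction.\<close>

definition sparse :: "('e + 'v \<times> nat) set \<Rightarrow> bool" where
  "sparse A \<longleftrightarrow> A \<subseteq> ground \<and> (\<forall>X. X \<noteq> {} \<longrightarrow> X \<subseteq> V \<longrightarrow>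
     card (inside A X) + h \<le> h * card X + colour_rank (colours A X))"

definition tight :: "('e + 'v \<times> nat) set \<Rightarrow> 'v set \<Rightarrow> bool" where
  "tight A X \<longleftrightarrow> X \<noteq> {} \<and> X \<subseteq> V \<and>
     card (inside A X) + h = h * card X + colour_rank (colours A X)"

definition crossing :: "('e + 'v \<times> nat) set \<Rightarrow> 'v set set \<Rightarrow> ('e + 'v \<times> nat) set" where
  "crossing A P = {x\<in>A. \<forall>X\<in>P. \<not> support ends x \<subseteq> X}"

lemma finite_ground: "finite ground"
  unfolding ground_def using finite_V finite_E by simp

lemma finite_if_subset_ground: "A \<subseteq> ground \<Longrightarrow> finite A"
  using finite_ground finite_subset by auto

lemma support_ground:
  assumes "x \<in> ground"
  shows "support ends x \<noteq> {}" "support ends x \<subseteq> V"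
  using assms ends_E unfolding ground_def by force+

lemma colours_subset: "A \<subseteq> ground \<Longrightarrow> colours A X \<subseteq> {1..k}"
  unfolding colours_def ground_def by auto

lemma finite_colours: "A \<subseteq> ground \<Longrightarrow> finite (colours A X)"
  using colours_subset finite_subset finite_atLeastAtMost by metis

lemma finite_inside: "A \<subseteq> ground \<Longrightarrow> finite (inside A X)"
  using finite_if_subset_ground unfolding inside_def by simp

lemma colours_mono: "A \<subseteq> B \<Longrightarrow> X \<subseteq> Y \<Longrightarrow> colours A X \<subseteq> colours B Y"
  unfolding colours_def by blast

lemma colours_Un: "colours A (X \<union> Y) = colours A X \<union> colours A Y"
  unfolding colours_def by blast

lemma colours_insert: "colours (insert x A) X = colours A X \<union> colours {x} X"
  unfolding colours_def by blast

lemma colours_singleton_cong: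
  assumes "support ends x \<subseteq> X" "support ends x \<subseteq> Y"
  shows "colours {x} X = colours {x} Y"
proof (cases x)
  case (Inr p)
  obtain v j where "p = (v, j)" by (cases p)
  then show ?thesis using assms Inr by (auto simp: colours_def)
qed (simp add: colours_def)

lemma colour_rank_mono: "J \<subseteq> J' \<Longrightarrow> finite J' \<Longrightarrow> colour_rank J \<le> colour_rank J'"
  unfolding colour_rank_def by (intro min.mono card_mono order_refl)

lemma colour_rank_submodular:
  "finite J \<Longrightarrow> finite J' \<Longrightarrow>
     colour_rank (J \<union> J') + colour_rank (J \<inter> J') \<le> colour_rank J + colour_rank J'"
  unfolding colour_rank_def by (rule min_card_submodular)

text \<open>The span of a set of colours grows with the set.\<close>

lemma colour_rank_absorb:
  assumes "colour_rank (J \<union> N) = colour_rank J" "J \<subseteq> J'" "finite J'" "finite N"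
  shows "colour_rank (J' \<union> N) = colour_rank J'"
proof -
  have fin: "finite (J \<union> N)" using assms finite_subset by auto
  have "colour_rank ((J \<union> N) \<union> J') + colour_rank ((J \<union> N) \<inter> J')
      \<le> colour_rank (J \<union> N) + colour_rank J'"
    by (rule colour_rank_submodular[OF fin assms(3)])
  moreover have "J \<union> N \<union> J' = J' \<union> N" using assms(2) by auto
  moreover have "colour_rank J \<le> colour_rank ((J \<union> N) \<inter> J')"
    using assms(2) fin by (intro colour_rank_mono) auto
  moreover have "colour_rank J' \<le> colour_rank (J' \<union> N)"
    using assms by (intro colour_rank_mono) auto
  ultimately show ?thesis using assms(1) by simp
qed

lemma card_inside_supermodular:
  assumes "A \<subseteq> ground"
  shows "card (inside A X) + card (inside A Y) \<le> card (inside A (X \<union> Y)) + card (inside A (X \<inter> Y))"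
proof -
  have "card (inside A X) + card (inside A Y)
      = card (inside A X \<union> inside A Y) + card (inside A X \<inter> inside A Y)"
    by (intro card_Un_Int finite_inside assms)
  moreover have "inside A X \<inter> inside A Y = inside A (X \<inter> Y)" unfolding inside_def by auto
  moreover have "card (inside A X \<union> inside A Y) \<le> card (inside A (X \<union> Y))"
    by (intro card_mono finite_inside assms) (auto simp: inside_def)
  ultimately show ?thesis by simp
qed

lemma sparseD:
  assumes "sparse A"
  shows "A \<subseteq> ground"
    and "X \<noteq> {} \<Longrightarrow> X \<subseteq> V \<Longrightarrow> card (inside A X) + h \<le> h * card X + colour_rank (colours A X)"
  using assms unfolding sparse_def by simp_all

lemma tightD:
  assumes "tight A X"
  shows "X \<noteq> {}" "X \<subseteq> V" "finite X"
    and "card (inside A X) + h = h * card X + colour_rank (colours A X)"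
  using assms finite_V finite_subset unfolding tight_def by auto

text \<open>Adding the equations of \<open>X\<close> and \<open>Y\<close> and using that the number of elements inside a set is
  supermodular, the cardinality modular and the colour rank submodular gives the reverse of the sum of
  the sparsity bounds of \<open>X \<union> Y\<close> and \<open>X \<inter> Y\<close>. So equality holds throughout, including in the
  submodular inequality for the colour rank; that last equation drives \<open>exists_exchange\<close>. The sets
  must intersect because the bound is only required of nonempty sets.\<close>

lemma tight_uncross:
  assumes A: "sparse A" and X: "tight A X" and Y: "tight A Y" and XY: "X \<inter> Y \<noteq> {}"
  shows "tight A (X \<union> Y)" "tight A (X \<inter> Y)"
    and "colour_rank (colours A X) + colour_rank (colours A Y)
      = colour_rank (colours A (X \<union> Y)) + colour_rank (colours A (X \<inter> Y))"
proof -
  note G = sparseD(1)[OF A]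
  have u: "card (inside A (X \<union> Y)) + h \<le> h * card (X \<union> Y) + colour_rank (colours A (X \<union> Y))"
    using XY tightD(2)[OF X] tightD(2)[OF Y] by (intro sparseD(2)[OF A]) auto
  have i: "card (inside A (X \<inter> Y)) + h \<le> h * card (X \<inter> Y) + colour_rank (colours A (X \<inter> Y))"
    using XY tightD(2)[OF X] by (intro sparseD(2)[OF A]) auto
  have "card X + card Y = card (X \<union> Y) + card (X \<inter> Y)"
    by (rule card_Un_Int) (use tightD X Y in auto)
  then have c: "h * card X + h * card Y = h * card (X \<union> Y) + h * card (X \<inter> Y)"
    by (metis distrib_left)
  have r: "colour_rank (colours A (X \<union> Y)) + colour_rank (colours A X \<inter> colours A Y)
      \<le> colour_rank (colours A X) + colour_rank (colours A Y)"
    unfolding colours_Un by (intro colour_rank_submodular finite_colours G)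
  have r': "colour_rank (colours A (X \<inter> Y)) \<le> colour_rank (colours A X \<inter> colours A Y)"
    using finite_colours[OF G] colours_mono[OF order_refl, of "X \<inter> Y"]
    by (intro colour_rank_mono) auto
  note all = u i c r r' tightD(4)[OF X] tightD(4)[OF Y] card_inside_supermodular[OF G, of X Y]
  show "colour_rank (colours A X) + colour_rank (colours A Y)
      = colour_rank (colours A (X \<union> Y)) + colour_rank (colours A (X \<inter> Y))"
    using all by linarith
  have "card (inside A (X \<union> Y)) + h = h * card (X \<union> Y) + colour_rank (colours A (X \<union> Y))"
    using all by linarith
  then show "tight A (X \<union> Y)"
    using XY tightD(2)[OF X] tightD(2)[OF Y] unfolding tight_def by auto
  have "card (inside A (X \<inter> Y)) + h = h * card (X \<inter> Y) + colour_rank (colours A (X \<inter> Y))"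
    using all by linarith
  then show "tight A (X \<inter> Y)"
    using XY tightD(2)[OF X] unfolding tight_def by auto
qed

lemma card_colours_singleton_le:
  assumes "A \<subseteq> ground"
  shows "card (colours A {v}) \<le> card (inside A {v})"
proof -
  have "(\<lambda>j. Inr (v, j)) ` colours A {v} \<subseteq> inside A {v}"
    unfolding colours_def inside_def by auto
  then have "card ((\<lambda>j. Inr (v, j) :: 'e + 'v \<times> nat) ` colours A {v}) \<le> card (inside A {v})"
    by (intro card_mono finite_inside assms)
  then show ?thesis by (simp add: card_image inj_on_def)
qed

text \<open>At a single vertex sparsity bounds the loops and roots by the number of colours, and
  distinct colours need distinct roots, so equality is forced. This is what makes the tight sets
  cover \<open>V\<close>, and it rules out loops.\<close>

lemma tight_singleton:
  assumes A: "sparse A" and v: "v \<in> V"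
  shows "tight A {v}"
  using sparseD(2)[OF A, of "{v}"] card_colours_singleton_le[OF sparseD(1)[OF A], of v] v
  unfolding tight_def colour_rank_def by auto

definition tight_parts :: "('e + 'v \<times> nat) set \<Rightarrow> 'v set set" where
  "tight_parts A = {X. tight A X \<and> (\<forall>Y. tight A Y \<longrightarrow> X \<subseteq> Y \<longrightarrow> Y = X)}"

lemma tight_subset_part:
  assumes "tight A Z"
  obtains X where "X \<in> tight_parts A" "Z \<subseteq> X"
proof -
  have "finite {X. tight A X}"
    by (rule finite_subset[of _ "Pow V"]) (auto simp: finite_V dest: tightD(2))
  from finite_has_maximal2[OF this, of Z] assms obtain X where
    "tight A X" "Z \<subseteq> X" "\<forall>Y\<in>{X. tight A X}. X \<subseteq> Y \<longrightarrow> X = Y" by auto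
  then show thesis by (intro that[of X]) (auto simp: tight_parts_def)
qed

lemma partition_tight_parts:
  assumes A: "sparse A"
  shows "partition_on V (tight_parts A)"
proof (rule partition_onI)
  show "\<Union> (tight_parts A) = V"
  proof
    show "\<Union> (tight_parts A) \<subseteq> V" unfolding tight_parts_def using tightD(2) by blast
    show "V \<subseteq> \<Union> (tight_parts A)"
    proof
      fix v assume "v \<in> V"
      then obtain X where "X \<in> tight_parts A" "{v} \<subseteq> X"
        using tight_subset_part[OF tight_singleton[OF A]] by metis
      then show "v \<in> \<Union> (tight_parts A)" by blast
    qed
  qed
  show "disjnt X Y" if "X \<in> tight_parts A" "Y \<in> tight_parts A" "X \<noteq> Y" for X Y
  proof (rule ccontr)
    assume "\<not> disjnt X Y"
    then have "tight A (X \<union> Y)"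
      using that by (intro tight_uncross(1)[OF A]) (auto simp: tight_parts_def disjnt_def)
    then have "X \<union> Y = X" "X \<union> Y = Y" using that unfolding tight_parts_def by blast+
    then show False using that by blast
  qed
  show "{} \<notin> tight_parts A" using tightD(1) unfolding tight_parts_def by blast
qed

text \<open>If adding \<open>x\<close> violates the bound at \<open>X\<close>, then the count inside \<open>X\<close> must have gone up by
  one while the bound was attained already and did not go up.\<close>

lemma new_element_blocked:
  assumes A: "sparse A" and x: "x \<in> ground" "x \<notin> A" and dep: "\<not> sparse (insert x A)"
  obtains X where "tight A X" "support ends x \<subseteq> X"
    "colour_rank (colours (insert x A) X) = colour_rank (colours A X)"
proof -
  note G = sparseD(1)[OF A]
  obtain X where X: "X \<noteq> {}" "X \<subseteq> V"
    and viol: "h * card X + colour_rank (colours (insert x A) X) < card (inside (insert x A) X) + h"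
    using dep G x unfolding sparse_def by (auto simp: not_le)
  note s = sparseD(2)[OF A X]
  have mono: "colour_rank (colours A X) \<le> colour_rank (colours (insert x A) X)"
    using G x by (intro colour_rank_mono colours_mono finite_colours) auto
  have sup: "support ends x \<subseteq> X"
  proof (rule ccontr)
    assume "\<not> support ends x \<subseteq> X"
    then have "inside (insert x A) X = inside A X" unfolding inside_def by auto
    then show False using viol s mono by simp
  qed
  then have "inside (insert x A) X = insert x (inside A X)" unfolding inside_def by auto
  then have "card (inside (insert x A) X) = Suc (card (inside A X))"
    using x finite_inside[OF G] by (simp add: inside_def)
  then have "card (inside A X) + h = h * card X + colour_rank (colours A X)"
    "colour_rank (colours (insert x A) X) = colour_rank (colours A X)"
    using viol s mono by linarith+
  then show thesis using that[of X] X sup by (simp add: tight_def)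
qed

lemma new_element_blocked_by_part:
  assumes A: "sparse A" and x: "x \<in> ground" "x \<notin> A" and dep: "\<not> sparse (insert x A)"
  obtains X where "X \<in> tight_parts A" "support ends x \<subseteq> X"
    "colour_rank (colours (insert x A) X) = colour_rank (colours A X)"
proof -
  note G = sparseD(1)[OF A]
  obtain Z where Z: "tight A Z" "support ends x \<subseteq> Z"
    "colour_rank (colours (insert x A) Z) = colour_rank (colours A Z)"
    by (rule new_element_blocked[OF A x dep])
  obtain X where X: "X \<in> tight_parts A" "Z \<subseteq> X" by (rule tight_subset_part[OF Z(1)])
  define N where "N = colours {x} Z"
  have finN: "finite N" unfolding N_def using x by (intro finite_colours) auto
  have "colours (insert x A) Z = colours A Z \<union> N" unfolding N_def by (rule colours_insert)
  then have "colour_rank (colours A Z \<union> N) = colour_rank (colours A Z)" using Z(3) by simp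
  from colour_rank_absorb[OF this colours_mono[OF order_refl X(2)] finite_colours[OF G] finN]
  have "colour_rank (colours A X \<union> N) = colour_rank (colours A X)" .
  moreover have sup: "support ends x \<subseteq> X" by (rule subset_trans[OF Z(2) X(2)])
  have "colours (insert x A) X = colours A X \<union> N"
    using colours_insert[of x A X] colours_singleton_cong[OF sup Z(2)] N_def by simp
  ultimately show thesis using that[OF X(1) sup] by simp
qed

lemma card_by_partition:
  assumes A: "A \<subseteq> ground" and P: "partition_on V P"
  shows "card A = (\<Sum>X\<in>P. card (inside A X)) + card (crossing A P)"
proof -
  have finP: "finite P" using P finite_V finite_elements by blast
  have "card (\<Union>X\<in>P. inside A X) = (\<Sum>X\<in>P. card (inside A X))"
  proof (rule card_UN_disjoint[OF finP])
    show "\<forall>X\<in>P. finite (inside A X)" using finite_inside[OF A] by blast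
    show "\<forall>X\<in>P. \<forall>Y\<in>P. X \<noteq> Y \<longrightarrow> inside A X \<inter> inside A Y = {}"
    proof (intro ballI impI)
      fix X Y assume "X \<in> P" "Y \<in> P" "X \<noteq> Y"
      then have "X \<inter> Y = {}" using partition_onD2[OF P] by (auto dest: disjointD)
      then show "inside A X \<inter> inside A Y = {}"
        unfolding inside_def using support_ground(1) A by blast
    qed
  qed
  moreover have "card A = card (\<Union>X\<in>P. inside A X) + card (crossing A P)"
    using finite_if_subset_ground[OF A]
    by (subst card_Un_disjoint[symmetric])
      (auto simp: inside_def crossing_def intro!: arg_cong[where f = card] intro: rev_finite_subset)
  ultimately show ?thesis by simp
qed

lemma sum_card_partition:
  assumes P: "partition_on V P"
  shows "(\<Sum>X\<in>P. h * card X) = h * card V"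
proof -
  have "card V = (\<Sum>X\<in>P. card X)"
    using product_partition[OF P] finite_V P by (metis Union_upper finite_subset partition_onD1)
  then show ?thesis by (simp add: sum_distrib_left)
qed

text \<open>Every partition gives an upper bound for the size of a sparse subset of \<open>A\<close>; the next lemma
  shows that for a maximal sparse subset \<open>I\<close> the partition into the maximal tight sets of \<open>I\<close>
  attains it. Together they make sparsity a matroid.\<close>

lemma card_sparse_le:
  assumes J: "sparse J" "J \<subseteq> A" and A: "A \<subseteq> ground" and P: "partition_on V P"
  shows "card J + h * card P
    \<le> h * card V + (\<Sum>X\<in>P. colour_rank (colours A X)) + card (crossing A P)"
proof -
  have "(\<Sum>X\<in>P. card (inside J X) + h) \<le> (\<Sum>X\<in>P. h * card X + colour_rank (colours A X))"
  proof (rule sum_mono)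
    fix X assume "X \<in> P"
    then have "X \<noteq> {}" "X \<subseteq> V" using P unfolding partition_on_def by auto
    then have "card (inside J X) + h \<le> h * card X + colour_rank (colours J X)"
      by (rule sparseD(2)[OF J(1)])
    also have "colour_rank (colours J X) \<le> colour_rank (colours A X)"
      by (intro colour_rank_mono colours_mono finite_colours J A order_refl)
    finally show "card (inside J X) + h \<le> h * card X + colour_rank (colours A X)" by simp
  qed
  moreover have "card (crossing J P) \<le> card (crossing A P)"
    using J(2) finite_if_subset_ground[OF A] by (intro card_mono) (auto simp: crossing_def)
  ultimately show ?thesis
    using card_by_partition[OF sparseD(1)[OF J(1)] P] sum_card_partition[OF P]
    by (simp add: sum.distrib mult.commute)
qed

text \<open>Each element of \<open>A\<close> outside \<open>I\<close> is blocked by a maximal tight set. Hence no edge outside \<open>I\<close>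
  crosses the partition, and the roots outside \<open>I\<close> only bring colours that \<open>I\<close> already spans there.\<close>

lemma card_maximal_sparse:
  assumes I: "sparse I" "I \<subseteq> A" and A: "A \<subseteq> ground"
    and max: "\<forall>x\<in>A - I. \<not> sparse (insert x I)"
  shows "card I + h * card (tight_parts I)
    = h * card V + (\<Sum>X\<in>tight_parts I. colour_rank (colours A X)) + card (crossing A (tight_parts I))"
proof -
  let ?P = "tight_parts I"
  have P: "partition_on V ?P" by (rule partition_tight_parts[OF I(1)])
  have blocked: "\<exists>X\<in>?P. support ends x \<subseteq> X \<and>
      colour_rank (colours (insert x I) X) = colour_rank (colours I X)" if x: "x \<in> A - I" for x
  proof -
    have "x \<in> ground" "x \<notin> I" "\<not> sparse (insert x I)" using x A max by auto
    then obtain X where "X \<in> ?P" "support ends x \<subseteq> X"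
      "colour_rank (colours (insert x I) X) = colour_rank (colours I X)"
      by (rule new_element_blocked_by_part[OF I(1)])
    then show ?thesis by blast
  qed
  have rank: "colour_rank (colours A X) = colour_rank (colours I X)" if X: "X \<in> ?P" for X
  proof (cases "card (colours I X) < h")
    case False
    moreover have "card (colours I X) \<le> card (colours A X)"
      by (intro card_mono finite_colours A colours_mono I order_refl)
    ultimately show ?thesis unfolding colour_rank_def by simp
  next
    case True
    have "colours A X \<subseteq> colours I X"
    proof
      fix j assume "j \<in> colours A X"
      then obtain v where v: "v \<in> X" "Inr (v, j) \<in> A" unfolding colours_def by auto
      show "j \<in> colours I X"
      proof (rule ccontr)
        assume j: "j \<notin> colours I X"
        then have "Inr (v, j) \<in> A - I" using v unfolding colours_def by auto
        from blocked[OF this] obtain Y where Y: "Y \<in> ?P" "v \<in> Y"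
          "colour_rank (colours (insert (Inr (v, j)) I) Y) = colour_rank (colours I Y)" by auto
        have "Y = X" using partition_onD2[OF P] X Y v(1) by (auto dest: disjointD)
        moreover have "colours (insert (Inr (v, j)) I) X = insert j (colours I X)"
          unfolding colours_def using v by auto
        ultimately show False
          using Y(3) True j finite_colours[OF sparseD(1)[OF I(1)], of X]
          unfolding colour_rank_def by auto
      qed
    qed
    then have "colours A X = colours I X" using colours_mono[OF I(2), of X X] by auto
    then show ?thesis by simp
  qed
  have cross: "crossing A ?P = crossing I ?P"
    unfolding crossing_def using blocked I(2) by blast
  have "(\<Sum>X\<in>?P. card (inside I X) + h) = (\<Sum>X\<in>?P. h * card X + colour_rank (colours A X))"
  proof (rule sum.cong[OF refl])
    fix X assume X: "X \<in> ?P"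
    then have "tight I X" unfolding tight_parts_def by simp
    from tightD(4)[OF this] show "card (inside I X) + h = h * card X + colour_rank (colours A X)"
      unfolding rank[OF X] .
  qed
  then have "(\<Sum>X\<in>?P. card (inside I X)) + h * card ?P
      = h * card V + (\<Sum>X\<in>?P. colour_rank (colours A X))"
    unfolding sum.distrib sum_card_partition[OF P] by (simp add: mult.commute)
  then show ?thesis
    unfolding cross card_by_partition[OF sparseD(1)[OF I(1)] P] by linarith
qed

lemma sparse_empty: "sparse {}"
proof -
  have "card (inside {} X) + h \<le> h * card X + colour_rank (colours {} X)"
    if "X \<noteq> {}" "X \<subseteq> V" for X
  proof -
    have "card X \<ge> 1"
      using that finite_V finite_subset[of X V] by (simp add: Suc_le_eq card_gt_0_iff)
    then have "h \<le> h * card X" using mult_le_mono2[of 1 "card X" h] by simp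
    moreover have "card (inside {} X) = 0" by (simp add: inside_def)
    ultimately show ?thesis by linarith
  qed
  then show ?thesis unfolding sparse_def by blast
qed

text \<open>Removing elements from \<open>X\<close> lowers the bound as well, but a removed element accounts for at
  most one lost colour.\<close>

lemma sparse_subset:
  assumes J: "sparse J" and IJ: "I \<subseteq> J"
  shows "sparse I"
  unfolding sparse_def
proof (intro conjI allI impI)
  note G = sparseD(1)[OF J]
  show GI: "I \<subseteq> ground" using IJ G by blast
  fix X assume X: "X \<noteq> {}" "X \<subseteq> V"
  define D where "D = inside J X - inside I X"
  have finD: "finite D" unfolding D_def using finite_inside[OF G] by simp
  have sub: "inside I X \<subseteq> inside J X" using IJ unfolding inside_def by auto
  have "colours J X \<subseteq> colours I X \<union> (\<lambda>x. snd (projr x)) ` D"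
  proof
    fix j assume "j \<in> colours J X"
    then obtain v where v: "v \<in> X" "Inr (v, j) \<in> J" unfolding colours_def by auto
    show "j \<in> colours I X \<union> (\<lambda>x. snd (projr x)) ` D"
    proof (cases "Inr (v, j) \<in> I")
      case True
      then show ?thesis using v unfolding colours_def by auto
    next
      case False
      then have "Inr (v, j) \<in> D" using v unfolding D_def inside_def by auto
      then have "snd (projr (Inr (v, j) :: 'e + 'v \<times> nat)) \<in> (\<lambda>x. snd (projr x)) ` D"
        by (rule imageI)
      then show ?thesis by simp
    qed
  qed
  then have "card (colours J X) \<le> card (colours I X \<union> (\<lambda>x. snd (projr x)) ` D)"
    using finD finite_colours[OF GI] by (intro card_mono) auto
  also have "\<dots> \<le> card (colours I X) + card D"
    using card_Un_le[of "colours I X" "(\<lambda>x. snd (projr x)) ` D"] card_image_le[OF finD, of "\<lambda>x. snd (projr x)"]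
    by linarith
  finally have "colour_rank (colours J X) \<le> colour_rank (colours I X) + card D"
    unfolding colour_rank_def by linarith
  moreover have "card (inside J X) = card (inside I X) + card D"
    unfolding D_def using sub finite_inside[OF G] finite_inside[OF GI]
    by (simp add: card_Diff_subset card_mono)
  ultimately show "card (inside I X) + h \<le> h * card X + colour_rank (colours I X)"
    using sparseD(2)[OF J X] by linarith
qed

lemma matroid_indep_sparse: "matroid_indep ground sparse"
  unfolding matroid_indep_def
proof (intro conjI allI impI)
  fix A I J
  assume "A \<subseteq> ground" "I \<subseteq> A" "sparse I" "\<forall>x\<in>A - I. \<not> sparse (insert x I)" "J \<subseteq> A" "sparse J"
  then show "card J \<le> card I"
    using card_maximal_sparse[of I A] card_sparse_le[of J A "tight_parts I"]
      partition_tight_parts[of I] by simp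
next
  fix I J assume "sparse J" "I \<subseteq> J"
  then show "sparse I" by (rule sparse_subset)
qed (rule finite_ground sparse_empty)+

lemma sparse_rank_formula:
  assumes A: "A \<subseteq> ground"
  obtains P where "partition_on V P"
    "indep_rank sparse A + h * card P
      = h * card V + (\<Sum>X\<in>P. colour_rank (colours A X)) + card (crossing A P)"
proof -
  obtain I where I: "I \<subseteq> A" "sparse I" "card I = indep_rank sparse A"
    "\<forall>x\<in>A - I. \<not> sparse (insert x I)"
    by (rule indep_rank_attained[OF matroid_indep_sparse A])
  show thesis
    by (rule that[OF partition_tight_parts[OF I(2)]])
      (use card_maximal_sparse[OF I(2,1) A I(4)] I(3) in simp)
qed

section \<open>Choosing edges and roots\<close>

text \<open>If \<open>A\<close> has no root of colour \<open>j\<close> in a member of the partition, all possible roots of colour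
  \<open>j\<close> in that member are outside \<open>A\<close>; one of them per member suffices below.\<close>

lemma card_missing_parts_le:
  assumes P: "partition_on V P" and j: "j \<in> {1..k}"
  shows "card {X\<in>P. j \<notin> colours A X} \<le> card {x \<in> ground - A. colour_of x = j}"
proof -
  have ne: "(SOME v. v \<in> X) \<in> X" if "X \<in> P" for X
    using that partition_onD3[OF P] by (metis some_in_eq)
  let ?f = "\<lambda>X. Inr (SOME v. v \<in> X, j) :: 'e + 'v \<times> nat"
  have "inj_on ?f {X\<in>P. j \<notin> colours A X}"
  proof (rule inj_onI)
    fix X Y assume "X \<in> {X\<in>P. j \<notin> colours A X}" "Y \<in> {X\<in>P. j \<notin> colours A X}" "?f X = ?f Y"
    then have "X \<in> P" "Y \<in> P" "(SOME v. v \<in> X) = (SOME v. v \<in> Y)" by auto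
    then have "X \<inter> Y \<noteq> {}" using ne[of X] ne[of Y] by auto
    then show "X = Y" using same_part[OF P \<open>X \<in> P\<close> \<open>Y \<in> P\<close>] by blast
  qed
  moreover have "?f ` {X\<in>P. j \<notin> colours A X} \<subseteq> {x \<in> ground - A. colour_of x = j}"
  proof
    fix x assume "x \<in> ?f ` {X\<in>P. j \<notin> colours A X}"
    then obtain X where X: "X \<in> P" "j \<notin> colours A X" "x = ?f X" by auto
    have "(SOME v. v \<in> X) \<in> V" using ne[OF X(1)] X(1) partition_onD1[OF P] by auto
    then have "x \<in> ground" using X(3) j unfolding ground_def by simp
    moreover have "x \<notin> A" using X ne[OF X(1)] unfolding colours_def by auto
    ultimately show "x \<in> {x \<in> ground - A. colour_of x = j}"
      using X(3) by (simp add: colour_of_def)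
  qed
  ultimately show ?thesis using finite_ground by (intro card_inj_on_le) auto
qed

lemma card_entering_le:
  assumes P: "partition_on V P" and A: "A \<subseteq> ground"
  shows "card (entering_edges E ends P)
    \<le> card (crossing A P) + card {x \<in> ground - A. colour_of x = 0}"
proof -
  let ?B = "{x \<in> ground - A. colour_of x = 0}"
  have "Inl ` entering_edges E ends P \<subseteq> crossing A P \<union> ?B"
  proof
    fix x :: "'e + 'v \<times> nat"
    assume "x \<in> Inl ` entering_edges E ends P"
    then obtain e X Y u v where e: "x = Inl e" "e \<in> E" "X \<in> P" "Y \<in> P" "X \<noteq> Y"
      "u \<in> X" "v \<in> Y" "ends e = {u, v}" unfolding entering_edges_def by blast
    have "\<not> ends e \<subseteq> Z" if "Z \<in> P" for Z
    proof
      assume "ends e \<subseteq> Z"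
      then have "u \<in> Z" "v \<in> Z" using e(8) by simp_all
      then have "Z = X" "Z = Y" using same_part[OF P that] e(3,4,6,7) by metis+
      then show False using e(5) by simp
    qed
    then show "x \<in> crossing A P \<union> ?B" using e(1,2) by (auto simp: crossing_def ground_def colour_of_def)
  qed
  moreover have "finite (crossing A P \<union> ?B)"
    using finite_ground finite_if_subset_ground[OF A] unfolding crossing_def by simp
  ultimately have "card (Inl ` entering_edges E ends P :: ('e + 'v \<times> nat) set) \<le> card (crossing A P \<union> ?B)"
    by (intro card_mono)
  also have "\<dots> \<le> card (crossing A P) + card ?B" by (rule card_Un_le)
  finally show ?thesis by (simp add: card_image)
qed

text \<open>The roots in \<open>A\<close> alone have at least this rank. In the rank formula this is seen by splitting
  each member \<open>X\<close> of the partition into singletons: one vertex contributes at most the colour rank of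
  \<open>X\<close>, each of the others at most \<open>h\<close>.\<close>

lemma sum_colour_rank_le_rank:
  assumes A: "A \<subseteq> ground"
  shows "(\<Sum>v\<in>V. colour_rank (colours A {v})) \<le> indep_rank sparse A"
proof -
  obtain P where P: "partition_on V P" and r: "indep_rank sparse A + h * card P
      = h * card V + (\<Sum>X\<in>P. colour_rank (colours A X)) + card (crossing A P)"
    by (rule sparse_rank_formula[OF A])
  have "h + (\<Sum>v\<in>X. colour_rank (colours A {v})) \<le> h * card X + colour_rank (colours A X)"
    if X: "X \<in> P" for X
  proof -
    have finX: "finite X" using X P finite_V finite_subset partition_onD1 by (metis Union_upper)
    obtain v where v: "v \<in> X" using X partition_onD3[OF P] by (metis all_not_in_conv)
    have "(\<Sum>w\<in>X - {v}. colour_rank (colours A {w})) \<le> (\<Sum>w\<in>X - {v}. h)"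
      by (intro sum_mono) (simp add: colour_rank_def)
    also have "\<dots> = h * (card X - 1)" using v finX by simp
    finally have "h + (\<Sum>w\<in>X - {v}. colour_rank (colours A {w})) \<le> h * (card X - 1) + h * 1" by simp
    also have "\<dots> = h * (card X - 1 + 1)" by (simp only: distrib_left)
    also have "card X - 1 + 1 = card X"
      using v finX by (metis Suc_eq_plus1 Suc_pred' card_gt_0_iff emptyE diff_Suc_1)
    finally have "h + (\<Sum>w\<in>X - {v}. colour_rank (colours A {w})) \<le> h * card X" .
    moreover have "colour_rank (colours A {v}) \<le> colour_rank (colours A X)"
      using v by (intro colour_rank_mono colours_mono finite_colours A) auto
    moreover have "(\<Sum>w\<in>X. colour_rank (colours A {w}))
        = colour_rank (colours A {v}) + (\<Sum>w\<in>X - {v}. colour_rank (colours A {w}))"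
      by (rule sum.remove[OF finX v])
    ultimately show ?thesis by linarith
  qed
  then have "(\<Sum>X\<in>P. h + (\<Sum>v\<in>X. colour_rank (colours A {v})))
      \<le> (\<Sum>X\<in>P. h * card X + colour_rank (colours A X))" by (rule sum_mono)
  then have "h * card P + (\<Sum>X\<in>P. \<Sum>v\<in>X. colour_rank (colours A {v}))
      \<le> h * card V + (\<Sum>X\<in>P. colour_rank (colours A X))"
    unfolding sum.distrib sum_card_partition[OF P] by (simp add: mult.commute)
  moreover have "(\<Sum>v\<in>V. colour_rank (colours A {v})) = (\<Sum>X\<in>P. \<Sum>v\<in>X. colour_rank (colours A {v}))"
    by (rule sum.partition[OF finite_V P])
  ultimately show ?thesis using r by linarith
qed

text \<open>The common independent set is asked to have \<open>h |V|\<close> elements, which is the sum of the caps, so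
  it has to meet every cap exactly. In the min-max condition for \<open>A\<close>, the edges outside \<open>A\<close> count
  fully unless they exceed their cap. If they count fully, then together with those crossing the
  partition of the rank formula they cover all entering edges, and the partition condition applies.
  If they exceed the cap, it remains to compare the roots with \<open>l 1 + \<dots> + l k\<close>, for which
  \<open>l i \<le> |V|\<close> and the bound on their sum are enough. Both cases use \<open>capped_family_sum\<close>, first for
  the partition of the rank formula and then for the partition into singletons.\<close>

lemma exists_full_sparse:
  assumes l: "\<And>i. i \<in> {1..k} \<Longrightarrow> l i \<le> card V" and tot: "(\<Sum>i=1..k. l i) \<le> h * card V"
    and cut: "\<And>P. partition_on V P \<Longrightarrow>
      h * card P \<le> (\<Sum>i=1..k. min (l i) (card P)) + card (entering_edges E ends P)"
  obtains I where "sparse I" "card I = h * card V"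
    "\<forall>j\<in>{1..k}. card {v. Inr (v, j) \<in> I} = l j"
proof -
  define m where "m = h * card V - (\<Sum>i=1..k. l i)"
  define cap where "cap j = (if j = 0 then m else l j)" for j
  define r2 where "r2 B = (\<Sum>j\<in>{0..k}. min (cap j) (card {x\<in>B. colour_of x = j}))"
    for B :: "('e + 'v \<times> nat) set"
  have split0: "(\<Sum>j\<in>{0..k}. f j) = f 0 + (\<Sum>j=1..k. f j)" for f :: "nat \<Rightarrow> nat"
    by (simp add: sum.atLeast_Suc_atMost)
  have r2_split: "r2 B = min m (card {x\<in>B. colour_of x = 0}) + (\<Sum>j=1..k. min (l j) (card {x\<in>B. colour_of x = j}))"
    for B :: "('e + 'v \<times> nat) set"
    unfolding r2_def split0 by (simp add: cap_def)
  have cap_sum: "(\<Sum>j\<in>{0..k}. cap j) = h * card V"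
    unfolding split0 using tot by (simp add: cap_def m_def)
  have "h * card V \<le> indep_rank sparse A + r2 (ground - A)" if A: "A \<subseteq> ground" for A
  proof -
    let ?B = "ground - A"
    let ?S = "\<Sum>j=1..k. min (l j) (card {x\<in>?B. colour_of x = j})"
    have family: "min (h * card P) (\<Sum>j=1..k. min (l j) (card P))
        \<le> (\<Sum>X\<in>P. colour_rank (colours A X)) + ?S" if P: "partition_on V P" for P
    proof -
      have "min (h * card P) (\<Sum>j=1..k. min (l j) (card P))
          \<le> (\<Sum>X\<in>P. min h (card (colours A X)))
            + (\<Sum>j=1..k. min (l j) (card {X\<in>P. j \<notin> colours A X}))"
        by (rule capped_family_sum[OF finite_elements[OF finite_V P] finite_atLeastAtMost])
          (rule colours_subset[OF A])
      also have "(\<Sum>j=1..k. min (l j) (card {X\<in>P. j \<notin> colours A X})) \<le> ?S"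
        by (intro sum_mono min.mono order_refl card_missing_parts_le P)
      finally show ?thesis unfolding colour_rank_def by simp
    qed
    show ?thesis
    proof (cases "card {x\<in>?B. colour_of x = 0} \<le> m")
      case True
      obtain P where P: "partition_on V P" and r: "indep_rank sparse A + h * card P
          = h * card V + (\<Sum>X\<in>P. colour_rank (colours A X)) + card (crossing A P)"
        by (rule sparse_rank_formula[OF A])
      have "card (entering_edges E ends P) \<le> card (crossing A P) + card {x\<in>?B. colour_of x = 0}"
        by (rule card_entering_le[OF P A])
      then show ?thesis
        using r True cut[OF P] family[OF P] unfolding r2_split by linarith
    next
      case False
      let ?P = "(\<lambda>v. {v}) ` V"
      have cP: "card ?P = card V" by (simp add: card_image)
      have "(\<Sum>j=1..k. min (l j) (card V)) = (\<Sum>j=1..k. l j)"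
        using l by (intro sum.cong) auto
      then have "(\<Sum>j=1..k. l j) \<le> (\<Sum>X\<in>?P. colour_rank (colours A X)) + ?S"
        using family[OF partition_on_singletons] tot unfolding cP by simp
      also have "(\<Sum>X\<in>?P. colour_rank (colours A X)) = (\<Sum>v\<in>V. colour_rank (colours A {v}))"
        by (subst sum.reindex) (simp_all add: inj_on_def)
      finally have "(\<Sum>j=1..k. l j) \<le> indep_rank sparse A + ?S"
        using sum_colour_rank_le_rank[OF A] by linarith
      then show ?thesis
        using False tot unfolding r2_split m_def by linarith
    qed
  qed
  then obtain I where I: "I \<subseteq> ground" "card I = h * card V"
    "indep_rank sparse I = h * card V" "r2 I = h * card V"
    using matroid_intersection[OF finite_ground matroid_rank_indep_rank[OF matroid_indep_sparse]
        matroid_rank_partition[OF finite_ground, of "{0..k}" cap colour_of], of "h * card V"]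
    unfolding r2_def by auto
  have "sparse I" using indep_if_rank_eq_card[OF matroid_indep_sparse I(1)] I by simp
  moreover note I(2)
  moreover have "\<forall>j\<in>{1..k}. card {v. Inr (v, j) \<in> I} = l j"
  proof
    fix j assume j: "j \<in> {1..k}"
    have finI: "finite I" by (rule finite_if_subset_ground[OF I(1)])
    have "(\<Sum>x\<in>I. card {j\<in>{0..k}. colour_of x = j}) = (\<Sum>j\<in>{0..k}. card {x\<in>I. colour_of x = j})"
      by (rule sum_multicount_gen[OF finI]) auto
    moreover have "card {j\<in>{0..k}. colour_of x = j} = 1" if "x \<in> I" for x
    proof -
      have "colour_of x \<le> k" using that I(1) by (auto simp: colour_of_def ground_def)
      then have "{j\<in>{0..k}. colour_of x = j} = {colour_of x}" by auto
      then show ?thesis by simp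
    qed
    ultimately have classes: "(\<Sum>j\<in>{0..k}. card {x\<in>I. colour_of x = j}) = h * card V"
      using I(2) by simp
    have j': "j \<in> {0..k}" using j by simp
    have "(\<Sum>j\<in>{0..k}. min (cap j) (card {x\<in>I. colour_of x = j})) = (\<Sum>j\<in>{0..k}. cap j)"
      using I(4) cap_sum unfolding r2_def by simp
    then have "min (cap j) (card {x\<in>I. colour_of x = j}) = cap j"
      by (rule sum_mono_inv[OF _ min.cobounded1 j' finite_atLeastAtMost])
    moreover have "(\<Sum>j\<in>{0..k}. min (cap j) (card {x\<in>I. colour_of x = j}))
        = (\<Sum>j\<in>{0..k}. card {x\<in>I. colour_of x = j})"
      using I(4) classes unfolding r2_def by simp
    then have "min (cap j) (card {x\<in>I. colour_of x = j}) = card {x\<in>I. colour_of x = j}"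
      by (rule sum_mono_inv[OF _ min.cobounded2 j' finite_atLeastAtMost])
    ultimately have "card {x\<in>I. colour_of x = j} = l j" using j by (simp add: cap_def)
    moreover have "{x\<in>I. colour_of x = j} = (\<lambda>v. Inr (v, j)) ` {v. Inr (v, j) \<in> I}"
    proof
      show "{x\<in>I. colour_of x = j} \<subseteq> (\<lambda>v. Inr (v, j)) ` {v. Inr (v, j) \<in> I}"
      proof
        fix x assume x: "x \<in> {x\<in>I. colour_of x = j}"
        then obtain v where "x = Inr (v, j)" using j by (cases x) (auto simp: colour_of_def)
        then show "x \<in> (\<lambda>v. Inr (v, j)) ` {v. Inr (v, j) \<in> I}" using x by simp
      qed
    qed (auto simp: colour_of_def)
    ultimately show "card {v. Inr (v, j) \<in> I} = l j" by (simp add: card_image inj_on_def)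
  qed
  ultimately show thesis by (rule that)
qed

section \<open>Growing the forests\<close>

text \<open>While the forests grow, a root \<open>(v, j)\<close> is read as a mark that \<open>v\<close> belongs to the \<open>j\<close>-th
  forest, so that its vertex set is determined by the current sparse set.\<close>

definition vertices_with :: "('e + 'v \<times> nat) set \<Rightarrow> nat \<Rightarrow> 'v set" where
  "vertices_with A j = {v. Inr (v, j) \<in> A}"

lemma card_edges_plus_colours:
  assumes A: "A \<subseteq> ground"
  shows "card A = card {e. Inl e \<in> A} + (\<Sum>v\<in>V. card (colours A {v}))"
proof -
  let ?S = "SIGMA v:V. colours A {v}"
  have eq: "A = Inl ` {e. Inl e \<in> A} \<union> Inr ` ?S"
  proof
    show "A \<subseteq> Inl ` {e. Inl e \<in> A} \<union> Inr ` ?S"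
    proof
      fix x assume x: "x \<in> A"
      show "x \<in> Inl ` {e. Inl e \<in> A} \<union> Inr ` ?S"
      proof (cases x)
        case (Inr p)
        then have "fst p \<in> V" using x A unfolding ground_def by auto
        then have "p \<in> ?S" using x Inr unfolding colours_def by (cases p) simp
        then show ?thesis using Inr by blast
      qed (use x in simp)
    qed
  qed (auto simp: colours_def)
  have "Inl ` {e. Inl e \<in> A} \<subseteq> A" by auto
  then have "finite (Inl ` {e. Inl e \<in> A} :: ('e + 'v \<times> nat) set)"
    using finite_if_subset_ground[OF A] finite_subset by blast
  moreover have "finite ?S" using finite_V finite_colours[OF A] by blast
  ultimately have "card (Inl ` {e. Inl e \<in> A} \<union> Inr ` ?S :: ('e + 'v \<times> nat) set)
      = card (Inl ` {e. Inl e \<in> A} :: ('e + 'v \<times> nat) set) + card (Inr ` ?S :: ('e + 'v \<times> nat) set)"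
    by (intro card_Un_disjoint) auto
  then have "card A = card (Inl ` {e. Inl e \<in> A} :: ('e + 'v \<times> nat) set) + card (Inr ` ?S :: ('e + 'v \<times> nat) set)"
    by (simp flip: eq)
  then show ?thesis using finite_V finite_colours[OF A] by (simp add: card_image card_SigmaI)
qed

lemma card_colours_le:
  assumes A: "sparse A" and v: "v \<in> V"
  shows "card (colours A {v}) \<le> h"
  using tightD(4)[OF tight_singleton[OF A v]] card_colours_singleton_le[OF sparseD(1)[OF A], of v]
  unfolding colour_rank_def by auto

text \<open>Only the sets \<open>X\<close> that contain \<open>v\<close> but not \<open>u\<close> gain an element. Such a set violates the
  bound afterwards only if it was tight and its colours already spanned \<open>j\<close>.\<close>

lemma sparse_after_exchange:
  assumes A: "sparse A" and e: "Inl e \<in> A" "ends e = {u, v}"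
    and u: "Inr (u, j) \<in> A" and v: "Inr (v, j) \<notin> A"
    and free: "\<And>Z. tight A Z \<Longrightarrow> v \<in> Z \<Longrightarrow> u \<notin> Z \<Longrightarrow>
      colour_rank (insert j (colours A Z)) \<noteq> colour_rank (colours A Z)"
  shows "sparse (insert (Inr (v, j)) (A - {Inl e}))" (is "sparse ?A'")
  unfolding sparse_def
proof (intro conjI allI impI)
  note G = sparseD(1)[OF A]
  have "v \<in> V" "j \<in> {1..k}" using G e u support_ground(2)[of "Inl e"] unfolding ground_def by auto
  then show G': "?A' \<subseteq> ground" using G unfolding ground_def by auto
  fix X assume X: "X \<noteq> {}" "X \<subseteq> V"
  note s = sparseD(2)[OF A X]
  have col: "colours ?A' X = (if v \<in> X then insert j (colours A X) else colours A X)"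
    unfolding colours_def by auto
  show "card (inside ?A' X) + h \<le> h * card X + colour_rank (colours ?A' X)"
  proof (cases "v \<in> X")
    case False
    then have "inside ?A' X \<subseteq> inside A X" unfolding inside_def by auto
    then have "card (inside ?A' X) \<le> card (inside A X)" by (intro card_mono finite_inside G)
    then show ?thesis using s False unfolding col by simp
  next
    case vX: True
    have mono: "colour_rank (colours A X) \<le> colour_rank (insert j (colours A X))"
      using finite_colours[OF G] by (intro colour_rank_mono) auto
    have new: "Inr (v, j) \<notin> inside A X" using v unfolding inside_def by simp
    show ?thesis
    proof (cases "u \<in> X")
      case True
      have "inside ?A' X = insert (Inr (v, j)) (inside A X - {Inl e})"
        using vX unfolding inside_def by auto
      moreover have "Inl e \<in> inside A X" using vX True e unfolding inside_def by simp
      ultimately have "card (inside ?A' X) = card (inside A X)"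
        using new finite_inside[OF G, of X] card.remove[of "inside A X" "Inl e"] by simp
      then show ?thesis using s mono vX unfolding col by simp
    next
      case False
      have "inside ?A' X = insert (Inr (v, j)) (inside A X)"
        using vX False e unfolding inside_def by auto
      then have c: "card (inside ?A' X) = card (inside A X) + 1"
        using new finite_inside[OF G, of X] by simp
      show ?thesis
      proof (cases "tight A X")
        case True
        then have "colour_rank (insert j (colours A X)) \<noteq> colour_rank (colours A X)"
          using free vX False by blast
        then show ?thesis using s mono c vX unfolding col by simp
      next
        case False
        then have "card (inside A X) + h \<noteq> h * card X + colour_rank (colours A X)"
          using X unfolding tight_def by simp
        then show ?thesis using s mono c vX unfolding col by simp
      qed
    qed
  qed
qed

text \<open>As an edge is left, some vertex has fewer than \<open>h\<close> colours although \<open>V\<close> is tight of colour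
  rank \<open>h\<close>. So there is a smallest tight set \<open>X\<close> whose colour rank exceeds that of one of its vertices
  \<open>v\<close>. Split \<open>X\<close> into the set \<open>Y\<close> of vertices whose colours all occur at \<open>v\<close> and the rest \<open>Z\<close>.
  Were there no edge between \<open>Y\<close> and \<open>Z\<close>, the bounds for \<open>Y\<close> and \<open>Z\<close> would add up to less than the
  equation of \<open>X\<close>. An edge between \<open>w\<close> in \<open>Y\<close> and \<open>u\<close> in \<open>Z\<close> can be used with any colour
  \<open>j\<close> of \<open>u\<close> that does not occur at \<open>v\<close>: an obstructing tight set \<open>T\<close> would make \<open>X \<inter> T\<close> tight and
  smaller than \<open>X\<close>, hence with no more colours than \<open>w\<close> has. Then \<open>j\<close> is spanned by the colours of \<open>X\<close>
  and by those of \<open>T\<close>, but not by those of \<open>X \<inter> T\<close>, against the modularity of the colour rank on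
  this pair.\<close>

lemma exists_exchange:
  assumes A: "sparse A" and full: "card A = h * card V" and e0: "Inl e0 \<in> A"
  obtains e u v j where "Inl e \<in> A" "ends e = {u, v}" "Inr (u, j) \<in> A" "Inr (v, j) \<notin> A"
    "sparse (insert (Inr (v, j)) (A - {Inl e}))"
proof -
  note G = sparseD(1)[OF A]
  define Q where "Q X \<longleftrightarrow> tight A X \<and>
    (\<exists>v\<in>X. colour_rank (colours A {v}) \<noteq> colour_rank (colours A X))" for X
  have "inside A V = A" using support_ground(2) G unfolding inside_def by blast
  then have fullV: "h \<le> colour_rank (colours A V)"
    using sparseD(2)[OF A V_nonempty order_refl] full by simp
  then have rankV: "colour_rank (colours A V) = h" unfolding colour_rank_def by simp
  have "Q V"
  proof -
    have "tight A V"
      using \<open>inside A V = A\<close> full rankV V_nonempty unfolding tight_def by simp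
    moreover have "\<exists>v\<in>V. colour_rank (colours A {v}) \<noteq> h"
    proof (rule ccontr)
      assume "\<not> ?thesis"
      then have "h \<le> card (colours A {v})" if "v \<in> V" for v
        using that unfolding colour_rank_def by (metis min.cobounded2)
      then have "(\<Sum>v\<in>V. h) \<le> (\<Sum>v\<in>V. card (colours A {v}))" by (rule sum_mono)
      then have "card {e. Inl e \<in> A} = 0"
        using card_edges_plus_colours[OF G] full by (simp add: mult.commute)
      moreover have "{e. Inl e \<in> A} \<subseteq> E" using G unfolding ground_def by auto
      then have "finite {e. Inl e \<in> A}" by (rule finite_subset[OF _ finite_E])
      ultimately show False using e0 by simp
    qed
    ultimately show ?thesis using rankV unfolding Q_def by simp
  qed
  then obtain X where X: "Q X" and min: "\<And>Y. Q Y \<Longrightarrow> card X \<le> card Y"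
    using ex_has_least_nat[of Q V card] by blast
  have tX: "tight A X" using X unfolding Q_def by simp
  obtain v where v: "v \<in> X" "colour_rank (colours A {v}) \<noteq> colour_rank (colours A X)"
    using X unfolding Q_def by blast
  have "colour_rank (colours A {v}) \<le> colour_rank (colours A X)"
    using v(1) by (intro colour_rank_mono colours_mono finite_colours[OF G]) auto
  then have lt: "colour_rank (colours A {v}) < colour_rank (colours A X)" using v(2) by simp
  then have small: "card (colours A {v}) < h" unfolding colour_rank_def by auto
  define Y where "Y = {w\<in>X. colours A {w} \<subseteq> colours A {v}}"
  define Z where "Z = X - Y"
  have vY: "v \<in> Y" using v(1) unfolding Y_def by simp
  have YV: "Y \<subseteq> V" "Z \<subseteq> V" using tightD(2)[OF tX] unfolding Y_def Z_def by auto
  have colY: "colours A Y \<subseteq> colours A {v}" unfolding Y_def colours_def by blast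
  then have rankY: "colour_rank (colours A Y) \<le> colour_rank (colours A {v})"
    by (intro colour_rank_mono finite_colours[OF G])
  have Zne: "Z \<noteq> {}"
  proof
    assume "Z = {}"
    then have "Y = X" unfolding Z_def Y_def by blast
    then show False using rankY lt by simp
  qed
  have "\<exists>x\<in>inside A X. x \<notin> inside A Y \<and> x \<notin> inside A Z"
  proof (rule ccontr)
    assume "\<not> ?thesis"
    then have "inside A X \<subseteq> inside A Y \<union> inside A Z" by blast
    then have "card (inside A X) \<le> card (inside A Y \<union> inside A Z)"
      using finite_inside[OF G] by (intro card_mono) auto
    also have "\<dots> \<le> card (inside A Y) + card (inside A Z)" by (rule card_Un_le)
    finally have 1: "card (inside A X) \<le> card (inside A Y) + card (inside A Z)" .
    have "card X = card Y + card Z"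
    proof -
      have "Y \<subseteq> X" unfolding Y_def by auto
      then show ?thesis unfolding Z_def
        using tightD(3)[OF tX] by (simp add: card_Diff_subset card_mono finite_subset)
    qed
    then have 2: "h * card X = h * card Y + h * card Z" by (simp add: distrib_left)
    have 3: "colour_rank (colours A Z) \<le> colour_rank (colours A X)"
      unfolding Z_def by (intro colour_rank_mono colours_mono finite_colours[OF G]) auto
    have 4: "colour_rank (colours A {v}) < h" using small unfolding colour_rank_def by simp
    have "Y \<noteq> {}" using vY by blast
    then show False
      using 1 2 3 4 rankY tightD(4)[OF tX] sparseD(2)[OF A _ YV(1)] sparseD(2)[OF A Zne YV(2)]
      by linarith
  qed
  then obtain x where x: "x \<in> A" "support ends x \<subseteq> X" "\<not> support ends x \<subseteq> Y" "\<not> support ends x \<subseteq> Z"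
    unfolding inside_def by blast
  obtain e where e: "x = Inl e"
  proof (cases x)
    case (Inr p)
    obtain w i where "p = (w, i)" by (cases p)
    then show thesis using x(2-4) Inr unfolding Z_def by simp
  qed
  obtain a b where ab: "ends e = {a, b}"
    using ends_E x(1) e G unfolding ground_def by blast
  obtain u w where uw: "ends e = {u, w}" "u \<in> Z" "w \<in> Y"
  proof (cases "a \<in> Y")
    case True
    then show thesis using that[of b a] x(2-4) e ab unfolding Z_def by auto
  next
    case False
    then show thesis using that[of a b] x(2-4) e ab unfolding Z_def by auto
  qed
  have "\<not> colours A {u} \<subseteq> colours A {v}" using uw(2) unfolding Z_def Y_def by blast
  then obtain j where j: "Inr (u, j) \<in> A" "j \<notin> colours A {v}" unfolding colours_def by blast
  have colw: "colours A {w} \<subseteq> colours A {v}" using uw(3) unfolding Y_def by blast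
  then have jw: "j \<notin> colours A {w}" using j(2) by blast
  then have wj: "Inr (w, j) \<notin> A" unfolding colours_def by simp
  have smallw: "card (colours A {w}) < h"
    using card_mono[OF finite_colours[OF G] colw] small by simp
  have uX: "u \<in> X" and wX: "w \<in> X" using uw(2,3) unfolding Z_def Y_def by auto
  have free: "colour_rank (insert j (colours A T)) \<noteq> colour_rank (colours A T)"
    if T: "tight A T" "w \<in> T" "u \<notin> T" for T
  proof
    assume absorbed: "colour_rank (insert j (colours A T)) = colour_rank (colours A T)"
    have ne: "X \<inter> T \<noteq> {}" using wX T(2) by blast
    note unc = tight_uncross[OF A tX T(1) ne]
    have "card (X \<inter> T) < card X"
      using uX T(3) tightD(3)[OF tX] by (intro psubset_card_mono) auto
    then have "\<not> Q (X \<inter> T)" using min[of "X \<inter> T"] by auto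
    then have eq: "colour_rank (colours A {w}) = colour_rank (colours A (X \<inter> T))"
      using unc(2) wX T(2) unfolding Q_def by blast
    have sub: "colours A {w} \<subseteq> colours A (X \<inter> T)"
      using wX T(2) by (intro colours_mono) auto
    have "card (colours A {w}) = card (colours A (X \<inter> T))"
      using eq smallw unfolding colour_rank_def by (auto simp: min_def split: if_splits)
    then have same: "colours A (X \<inter> T) = colours A {w}"
      using card_subset_eq[OF finite_colours[OF G] sub] by simp
    have gain: "colour_rank (insert j (colours A (X \<inter> T))) = colour_rank (colours A (X \<inter> T)) + 1"
      unfolding same colour_rank_def using jw smallw finite_colours[OF G] by simp
    have jX: "insert j (colours A X) = colours A X" using j(1) uX unfolding colours_def by blast
    have "colour_rank (colours A X \<union> insert j (colours A T))
          + colour_rank (colours A X \<inter> insert j (colours A T))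
        \<le> colour_rank (colours A X) + colour_rank (insert j (colours A T))"
      using finite_colours[OF G] by (intro colour_rank_submodular) auto
    moreover have "colour_rank (colours A (X \<union> T)) \<le> colour_rank (colours A X \<union> insert j (colours A T))"
      using finite_colours[OF G] by (intro colour_rank_mono) (auto simp: colours_Un)
    moreover have "colour_rank (insert j (colours A (X \<inter> T)))
        \<le> colour_rank (colours A X \<inter> insert j (colours A T))"
    proof (rule colour_rank_mono)
      have "colours A (X \<inter> T) \<subseteq> colours A X" "colours A (X \<inter> T) \<subseteq> colours A T"
        by (intro colours_mono; blast)+
      then show "insert j (colours A (X \<inter> T)) \<subseteq> colours A X \<inter> insert j (colours A T)"
        using jX by blast
    qed (use finite_colours[OF G] in simp)
    ultimately show False using unc(3) gain absorbed by linarith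
  qed
  have "sparse (insert (Inr (w, j)) (A - {Inl e}))"
    by (rule sparse_after_exchange[OF A _ uw(1) j(1) wj free]) (use x(1) e in simp)
  then show thesis using that[of e u w j] x(1) e uw(1) j(1) wj by blast
qed

text \<open>The invariant couples the sparse set \<open>A\<close>, whose edges are the unused ones, with forests whose
  vertex sets are given by the marks in \<open>A\<close>.\<close>

lemma grow_forests:
  assumes "sparse A" "card A = h * card V"
    and "\<And>i e. i \<in> {1..k} \<Longrightarrow> e \<in> F i \<Longrightarrow> e \<in> E \<and> Inl e \<notin> A \<and> ends e \<subseteq> vertices_with A i"
    and "\<And>i. i \<in> {1..k} \<Longrightarrow> acyclic_edges ends (F i)"
    and "\<And>i. i \<in> {1..k} \<Longrightarrow> card (components_of ends (vertices_with A i) (F i)) = l i"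
    and "disjoint_family_on F {1..k}"
  shows "\<exists>W F. forest_packing V E ends k W F \<and> regular_packing V h k W \<and>
    (\<forall>i\<in>{1..k}. card (components_of ends (W i) (F i)) = l i)"
  using assms
proof (induction "card {e. Inl e \<in> A}" arbitrary: A F)
  case 0
  note A = \<open>sparse A\<close> and full = \<open>card A = h * card V\<close>
  note G = sparseD(1)[OF A]
  have "(\<Sum>v\<in>V. card (colours A {v})) = (\<Sum>v\<in>V. h)"
    using card_edges_plus_colours[OF G] full 0(1) by (simp add: mult.commute)
  then have col: "card (colours A {v}) = h" if "v \<in> V" for v
    by (rule sum_mono_inv[OF _ _ that finite_V]) (rule card_colours_le[OF A])
  have "{i\<in>{1..k}. v \<in> vertices_with A i} = colours A {v}" for v
    using colours_subset[OF G, of "{v}"] unfolding vertices_with_def colours_def by auto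
  then have "regular_packing V h k (vertices_with A)"
    unfolding regular_packing_def using col by simp
  moreover have "vertices_with A i \<subseteq> V" for i
    using G unfolding vertices_with_def ground_def by auto
  then have "forest_packing V E ends k (vertices_with A) F"
    unfolding forest_packing_def subgraph_of_def using 0(4,5,7) by blast
  ultimately show ?case using 0(6) by blast
next
  case (Suc n)
  note A = \<open>sparse A\<close> and full = \<open>card A = h * card V\<close>
  note G = sparseD(1)[OF A]
  have "{e. Inl e \<in> A} \<noteq> {}" using Suc.hyps(2) by force
  then obtain e0 where "Inl e0 \<in> A" by blast
  then obtain e u v j where e: "Inl e \<in> A" "ends e = {u, v}" "Inr (u, j) \<in> A" "Inr (v, j) \<notin> A"
    "sparse (insert (Inr (v, j)) (A - {Inl e}))"
    by (rule exists_exchange[OF A full])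
  define A' where "A' = insert (Inr (v, j)) (A - {Inl e})"
  define F' where "F' = F(j := insert e (F j))"
  have uv: "u \<noteq> v" using e by auto
  have j: "j \<in> {1..k}" using e(3) G unfolding ground_def by auto
  have W: "vertices_with A' i = (if i = j then insert v (vertices_with A j) else vertices_with A i)" for i
    unfolding A'_def vertices_with_def by auto
  have u: "u \<in> vertices_with A j" and v: "v \<notin> vertices_with A j"
    using e unfolding vertices_with_def by auto
  have eE: "e \<in> E" using e(1) G unfolding ground_def by auto
  have eF: "e \<notin> F i" if "i \<in> {1..k}" for i using Suc.prems(3)[OF that] e(1) by blast
  have fin: "finite A" by (rule finite_if_subset_ground[OF G])
  show ?case
  proof (rule Suc.hyps(1)[of A' F'])
    have "{e. Inl e \<in> A'} = {e. Inl e \<in> A} - {e}" unfolding A'_def by auto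
    then show "n = card {e. Inl e \<in> A'}" using Suc.hyps(2) e(1) by simp
    show "sparse A'" using e(5) unfolding A'_def .
    have "card A' = Suc (card (A - {Inl e}))"
      unfolding A'_def using e(4) fin by (intro card_insert_disjoint) auto
    also have "\<dots> = card A" using card.remove[OF fin e(1)] by simp
    finally show "card A' = h * card V" unfolding full .
    show "f \<in> E \<and> Inl f \<notin> A' \<and> ends f \<subseteq> vertices_with A' i" if i: "i \<in> {1..k}" and f: "f \<in> F' i" for i f
    proof (cases "f = e")
      case True
      then have "i = j" using f eF[OF i] unfolding F'_def by (auto split: if_splits)
      then show ?thesis using True eE e(2) u unfolding W by (auto simp: A'_def)
    next
      case False
      then have "f \<in> F i" using f unfolding F'_def by (auto split: if_splits)
      then show ?thesis using Suc.prems(3)[OF i] unfolding W by (auto simp: A'_def)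
    qed
    have ends_F: "ends f \<subseteq> vertices_with A j" if "f \<in> F j" for f
      using Suc.prems(3)[OF j that] by blast
    show "acyclic_edges ends (F' i)" if i: "i \<in> {1..k}" for i
    proof (cases "i = j")
      case True
      have "acyclic_edges ends (insert e (F j))"
        by (rule acyclic_edges_pendant[OF Suc.prems(4)[OF j] e(2) uv]) (use ends_F v in blast)
      then show ?thesis using True unfolding F'_def by simp
    qed (use Suc.prems(4)[OF i] in \<open>simp add: F'_def\<close>)
    show "card (components_of ends (vertices_with A' i) (F' i)) = l i" if i: "i \<in> {1..k}" for i
    proof (cases "i = j")
      case True
      have "card (components_of ends (insert v (vertices_with A j)) (insert e (F j))) = l j"
        using card_components_pendant[of u "vertices_with A j" v ends e "F j", OF u v e(2) ends_F]
          Suc.prems(5)[OF j] by simp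
      then show ?thesis using True unfolding F'_def W by simp
    qed (use Suc.prems(5)[OF i] in \<open>simp add: F'_def W\<close>)
    show "disjoint_family_on F' {1..k}"
      using Suc.prems(6) eF j unfolding disjoint_family_on_def F'_def by auto
  qed
qed

end

section \<open>Necessity and conclusion\<close>

context multigraph
begin

lemma sum_components_le:
  assumes pack: "forest_packing V E ends k W F" and reg: "regular_packing V h k W"
  shows "(\<Sum>i=1..k. card (components_of ends (W i) (F i))) \<le> h * card V"
proof -
  have WV: "W i \<subseteq> V" if "i \<in> {1..k}" for i
    using pack that unfolding forest_packing_def subgraph_of_def by blast
  have "(\<Sum>i\<in>{1..k}. card (components_of ends (W i) (F i))) \<le> (\<Sum>i\<in>{1..k}. card {v\<in>V. v \<in> W i})"
  proof (rule sum_mono)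
    fix i assume i: "i \<in> {1..k}"
    have "{v\<in>V. v \<in> W i} = W i" "finite (W i)"
      using WV[OF i] finite_subset[OF WV[OF i] finite_V] by auto
    then show "card (components_of ends (W i) (F i)) \<le> card {v\<in>V. v \<in> W i}"
      using card_components_le by simp
  qed
  also have "\<dots> = (\<Sum>v\<in>V. h)"
    using reg unfolding regular_packing_def by (intro sum_multicount_gen finite_V) auto
  finally show ?thesis by (simp add: mult.commute)
qed

lemma partition_condition_necessary:
  assumes pack: "forest_packing V E ends k W F" and reg: "regular_packing V h k W"
    and P: "partition_on V P"
  shows "h * card P \<le> (\<Sum>i=1..k. min (card (components_of ends (W i) (F i))) (card P))
    + card (entering_edges E ends P)"
proof -
  let ?N = "entering_edges E ends P"
  let ?c = "\<lambda>i. card (components_of ends (W i) (F i))"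
  have finP: "finite P" by (rule finite_elements[OF finite_V P])
  have sub: "W i \<subseteq> V" "F i \<subseteq> E" "\<And>e. e \<in> F i \<Longrightarrow> ends e \<subseteq> W i" if "i \<in> {1..k}" for i
    using pack that unfolding forest_packing_def subgraph_of_def by blast+
  \<comment> \<open>the contraction of the members of \<open>P\<close>; it is constant along the edges that do not enter \<open>P\<close>\<close>
  define f where "f v = (THE X. X \<in> P \<and> v \<in> X)" for v
  have f_eq: "f v = X" if "X \<in> P" "v \<in> X" for v X
    unfolding f_def using that same_part[OF P] by (intro the_equality) auto
  have f_in: "f v \<in> P \<and> v \<in> f v" if "v \<in> V" for v
    using that partition_onD1[OF P] f_eq by blast
  have forest: "card (f ` W i) \<le> min (?c i) (card P) + card (F i \<inter> ?N)" if i: "i \<in> {1..k}" for i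
  proof -
    have "f a = f b" if e: "e \<in> F i - F i \<inter> ?N" "ends e = {a, b}" for e a b
    proof (rule ccontr)
      assume ne: "f a \<noteq> f b"
      have "ends e \<subseteq> V" using sub(3)[OF i, of e] e(1) sub(1)[OF i] by blast
      then have "f a \<in> P" "a \<in> f a" "f b \<in> P" "b \<in> f b" using f_in e(2) by auto
      moreover have "e \<in> E" using e(1) sub(2)[OF i] by blast
      ultimately have "e \<in> ?N"
        unfolding entering_edges_def using ne e(2) by blast
      then show False using e(1) by blast
    qed
    then have "card (f ` W i) \<le> ?c i + card (F i \<inter> ?N)"
      using finite_subset[OF sub(1)[OF i] finite_V] finite_subset[OF sub(2)[OF i] finite_E]
      by (intro card_image_le_components) auto
    moreover have "card (f ` W i) \<le> card P"
      using f_in sub(1)[OF i] finP by (intro card_mono) auto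
    ultimately show ?thesis by linarith
  qed
  have "h * card P = (\<Sum>X\<in>P. h)" by (simp add: mult.commute)
  also have "\<dots> \<le> (\<Sum>X\<in>P. card {i\<in>{1..k}. X \<in> f ` W i})"
  proof (rule sum_mono)
    fix X assume X: "X \<in> P"
    then obtain v where v: "v \<in> X" using partition_onD3[OF P] by (metis all_not_in_conv)
    have "v \<in> V" using X v partition_onD1[OF P] by blast
    then have "h = card {i\<in>{1..k}. v \<in> W i}" using reg unfolding regular_packing_def by simp
    also have "\<dots> \<le> card {i\<in>{1..k}. X \<in> f ` W i}"
      using f_eq[OF X v] by (intro card_mono) auto
    finally show "h \<le> card {i\<in>{1..k}. X \<in> f ` W i}" .
  qed
  also have "\<dots> = (\<Sum>i\<in>{1..k}. card {X\<in>P. X \<in> f ` W i})"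
    by (intro sum_multicount_gen finP) auto
  also have "\<dots> \<le> (\<Sum>i\<in>{1..k}. min (?c i) (card P) + card (F i \<inter> ?N))"
  proof (rule sum_mono)
    fix i assume i: "i \<in> {1..k}"
    have "{X\<in>P. X \<in> f ` W i} = f ` W i" using f_in sub(1)[OF i] by blast
    then show "card {X\<in>P. X \<in> f ` W i} \<le> min (?c i) (card P) + card (F i \<inter> ?N)"
      using forest[OF i] by simp
  qed
  also have "\<dots> = (\<Sum>i\<in>{1..k}. min (?c i) (card P)) + (\<Sum>i\<in>{1..k}. card (F i \<inter> ?N))"
    by (rule sum.distrib)
  also have "(\<Sum>i\<in>{1..k}. card (F i \<inter> ?N)) \<le> card ?N"
  proof -
    have finN: "finite ?N" using finite_E unfolding entering_edges_def by simp
    have "disjoint_family_on F {1..k}" using pack unfolding forest_packing_def by simp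
    then have disj: "\<forall>i\<in>{1..k}. \<forall>i'\<in>{1..k}. i \<noteq> i' \<longrightarrow> F i \<inter> ?N \<inter> (F i' \<inter> ?N) = {}"
      unfolding disjoint_family_on_def by blast
    have "(\<Sum>i\<in>{1..k}. card (F i \<inter> ?N)) = card (\<Union>i\<in>{1..k}. F i \<inter> ?N)"
      by (rule card_UN_disjoint[OF finite_atLeastAtMost _ disj, symmetric]) (use finN in simp)
    also have "\<dots> \<le> card ?N" using finN by (intro card_mono) auto
    finally show ?thesis .
  qed
  finally show ?thesis by simp
qed

lemma exists_regular_packing:
  assumes "\<And>i. i \<in> {1..k} \<Longrightarrow> l i \<le> card V" and "(\<Sum>i=1..k. l i) \<le> h * card V"
    and "\<And>P. partition_on V P \<Longrightarrow>
      h * card P \<le> (\<Sum>i=1..k. min (l i) (card P)) + card (entering_edges E ends P)"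
  shows "\<exists>W F. forest_packing V E ends k W F \<and> regular_packing V h k W \<and>
    (\<forall>i\<in>{1..k}. card (components_of ends (W i) (F i)) = l i)"
proof -
  interpret coloured_multigraph V E ends h k ..
  obtain A where A: "sparse A" "card A = h * card V"
    "\<forall>j\<in>{1..k}. card {v. Inr (v, j) \<in> A} = l j"
    by (rule exists_full_sparse[OF assms])
  show ?thesis
  proof (rule grow_forests[OF A(1,2)])
    show "acyclic_edges ends {}" for i :: nat
      unfolding acyclic_edges_def is_cycle_def by auto
    show "card (components_of ends (vertices_with A i) {}) = l i" if "i \<in> {1..k}" for i
      using A(3) that unfolding card_components_edgeless vertices_with_def by blast
  qed (auto simp: disjoint_family_on_def)
qed

end

theorem theorem14:
  fixes V :: "'v set" and E :: "'e set" and ends :: "'e \<Rightarrow> 'v set"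
    and h k :: nat and l :: "nat \<Rightarrow> nat"
  assumes "multigraph V E ends"
    and "h > 0" and "k > 0" and "\<forall>i\<in>{1..k}. l i > 0"
  shows "(\<exists>W F. forest_packing V E ends k W F \<and> regular_packing V h k W \<and>
            (\<forall>i\<in>{1..k}. card (components_of ends (W i) (F i)) = l i))
    \<longleftrightarrow>
      (\<forall>i\<in>{1..k}. card V \<ge> l i) \<and>
      h * card V \<ge> (\<Sum>i=1..k. l i) \<and>
      (\<forall>P. partition_on V P \<longrightarrow>
         (\<Sum>i=1..k. min (l i) (card P)) + card (entering_edges E ends P) \<ge> h * card P)"
    (is "?packing \<longleftrightarrow> ?conditions")
proof
  interpret multigraph V E ends by fact
  show ?packing if ?conditions
    using that by (intro exists_regular_packing) auto
  show ?conditions if ?packing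
  proof -
    obtain W F where pack: "forest_packing V E ends k W F" and reg: "regular_packing V h k W"
      and l: "\<And>i. i \<in> {1..k} \<Longrightarrow> card (components_of ends (W i) (F i)) = l i"
      using \<open>?packing\<close> by blast
    have "l i \<le> card V" if i: "i \<in> {1..k}" for i
    proof -
      have W: "W i \<subseteq> V" using pack i unfolding forest_packing_def subgraph_of_def by blast
      then have "card (components_of ends (W i) (F i)) \<le> card (W i)"
        by (intro card_components_le finite_subset[OF _ finite_V])
      also have "\<dots> \<le> card V" by (rule card_mono[OF finite_V W])
      finally show ?thesis using l[OF i] by simp
    qed
    then show ?thesis
      using sum_components_le[OF pack reg] partition_condition_necessary[OF pack reg] l by simp
  qed
qed

end
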